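(* The category $\mathrm{Flag}_{\mathrm{fin}}$ is Krull-Schmidt, and in particular the commutative monoid $\mathfrak{J}(\mathrm{Flag}_{\mathrm{fin}})$ of isomorphism classes of its objects under direct sum is $$\mathfrak{J}(\mathrm{Flag}_{\mathrm{fin}})=\{(m_1,\dots,m_n,0,\dots)\in\mathbb{N}^\infty:\ m_1\geq\cdots\geq m_n\geq0\},$$ where the isomorphism class of a flag $V_\star$ is identified with its dimension sequence $(\dim V_1,\dim V_2,\dots)$.
   Context: Fix a field $K$. A flag $V_\star$ is a non-increasing sequence of $K$-vector spaces $V_1\supseteq V_2\supseteq\cdots\supseteq V_\ell\supseteq\cdots$. It has finite depth if $V_n=0$ for some $n$, and is finite-dimensional if $\dim V_1<\infty$. A morphism $f:V_\star\to W_\star$ is a linear map $f:V_1\to W_1$ with $f(V_\ell)\subseteq W_\ell$ for all $\ell$. $\mathrm{Flag}_{\mathrm{fin}}$ is the category of finite-depth, finite-dimensional flags. Direct sums are levelwise: $(V\oplus W)_\ell=V_\ell\oplus W_\ell$. The sequences on the right-hand side are the non-increasing, eventually zero sequences of non-negative integers ($n$ arbitrary), with componentwise addition. *)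

theory Defs
  imports "Jordan_Normal_Form.Missing_VectorSpace" "HOL-Library.Equipollence"
begin

section \<open>Preadditive, additive and Krull-Schmidt categories\<close>

text \<open>The morphisms from \<open>X\<close> to \<open>Y\<close> form the additive group \<open>mor C X Y\<close>; the multiplicative fields
  of that record are ignored. In \<open>cmp C X Y Z g f\<close> the morphism \<open>f : X \<rightarrow> Y\<close> is applied first.\<close>

record ('o, 'm) precat =
  obj :: "'o set"
  mor :: "'o \<Rightarrow> 'o \<Rightarrow> 'm ring"
  idn :: "'o \<Rightarrow> 'm"
  cmp :: "'o \<Rightarrow> 'o \<Rightarrow> 'o \<Rightarrow> 'm \<Rightarrow> 'm \<Rightarrow> 'm"

locale preadditive_category =
  fixes C :: "('o, 'm) precat"
  assumes mor_group: "\<lbrakk>X \<in> obj C; Y \<in> obj C\<rbrakk> \<Longrightarrow> abelian_group (mor C X Y)"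
    and idn_closed: "X \<in> obj C \<Longrightarrow> idn C X \<in> carrier (mor C X X)"
    and cmp_closed: "\<lbrakk>X \<in> obj C; Y \<in> obj C; Z \<in> obj C;
        f \<in> carrier (mor C X Y); g \<in> carrier (mor C Y Z)\<rbrakk>
      \<Longrightarrow> cmp C X Y Z g f \<in> carrier (mor C X Z)"
    and cmp_idn: "\<lbrakk>X \<in> obj C; Y \<in> obj C; f \<in> carrier (mor C X Y)\<rbrakk>
      \<Longrightarrow> cmp C X X Y f (idn C X) = f"
    and idn_cmp: "\<lbrakk>X \<in> obj C; Y \<in> obj C; f \<in> carrier (mor C X Y)\<rbrakk>
      \<Longrightarrow> cmp C X Y Y (idn C Y) f = f"
    and cmp_assoc: "\<lbrakk>W \<in> obj C; X \<in> obj C; Y \<in> obj C; Z \<in> obj C;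
        f \<in> carrier (mor C W X); g \<in> carrier (mor C X Y); h \<in> carrier (mor C Y Z)\<rbrakk>
      \<Longrightarrow> cmp C W Y Z h (cmp C W X Y g f) = cmp C W X Z (cmp C X Y Z h g) f"
    and cmp_add_left: "\<lbrakk>X \<in> obj C; Y \<in> obj C; Z \<in> obj C; f \<in> carrier (mor C X Y);
        g \<in> carrier (mor C Y Z); h \<in> carrier (mor C Y Z)\<rbrakk>
      \<Longrightarrow> cmp C X Y Z (g \<oplus>\<^bsub>mor C Y Z\<^esub> h) f = cmp C X Y Z g f \<oplus>\<^bsub>mor C X Z\<^esub> cmp C X Y Z h f"
    and cmp_add_right: "\<lbrakk>X \<in> obj C; Y \<in> obj C; Z \<in> obj C; f \<in> carrier (mor C X Y);
        g \<in> carrier (mor C X Y); h \<in> carrier (mor C Y Z)\<rbrakk>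
      \<Longrightarrow> cmp C X Y Z h (f \<oplus>\<^bsub>mor C X Y\<^esub> g) = cmp C X Y Z h f \<oplus>\<^bsub>mor C X Z\<^esub> cmp C X Y Z h g"

text \<open>\<open>X\<close> is a biproduct of the list \<open>Ys\<close> with injections \<open>\<iota> i\<close> and projections \<open>\<pi> i\<close>. For the empty
  list this says that the identity of \<open>X\<close> is zero, that is, that \<open>X\<close> is a zero object.\<close>

definition is_biproduct ::
  "('o, 'm) precat \<Rightarrow> 'o list \<Rightarrow> 'o \<Rightarrow> (nat \<Rightarrow> 'm) \<Rightarrow> (nat \<Rightarrow> 'm) \<Rightarrow> bool" where
  "is_biproduct C Ys X \<iota> \<pi> \<longleftrightarrow>
     X \<in> obj C \<and> set Ys \<subseteq> obj C \<and>
     (\<forall>i<length Ys. \<iota> i \<in> carrier (mor C (Ys ! i) X) \<and> \<pi> i \<in> carrier (mor C X (Ys ! i))) \<and>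
     (\<forall>i<length Ys. \<forall>j<length Ys.
        cmp C (Ys ! i) X (Ys ! j) (\<pi> j) (\<iota> i) =
          (if i = j then idn C (Ys ! i) else \<zero>\<^bsub>mor C (Ys ! i) (Ys ! j)\<^esub>)) \<and>
     (\<Oplus>\<^bsub>mor C X X\<^esub>i\<in>{..<length Ys}. cmp C X (Ys ! i) X (\<iota> i) (\<pi> i)) = idn C X"

definition is_direct_sum :: "('o, 'm) precat \<Rightarrow> 'o list \<Rightarrow> 'o \<Rightarrow> bool" where
  "is_direct_sum C Ys X \<longleftrightarrow> (\<exists>\<iota> \<pi>. is_biproduct C Ys X \<iota> \<pi>)"

definition additive_category :: "('o, 'm) precat \<Rightarrow> bool" where
  "additive_category C \<longleftrightarrow>
     preadditive_category C \<and> (\<forall>Ys. set Ys \<subseteq> obj C \<longrightarrow> (\<exists>X. is_direct_sum C Ys X))"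

definition end_ring :: "('o, 'm) precat \<Rightarrow> 'o \<Rightarrow> 'm ring" where
  "end_ring C X = (mor C X X)\<lparr>mult := cmp C X X X, one := idn C X\<rparr>"

text \<open>Local rings need not be commutative.\<close>

definition local_ring :: "('a, 'b) ring_scheme \<Rightarrow> bool" where
  "local_ring R \<longleftrightarrow> ring R \<and> \<one>\<^bsub>R\<^esub> \<noteq> \<zero>\<^bsub>R\<^esub> \<and>
     (\<forall>a \<in> carrier R - Units R. \<forall>b \<in> carrier R - Units R. a \<oplus>\<^bsub>R\<^esub> b \<notin> Units R)"

definition krull_schmidt :: "('o, 'm) precat \<Rightarrow> bool" where
  "krull_schmidt C \<longleftrightarrow> additive_category C \<and>
     (\<forall>X \<in> obj C. \<exists>Ys. is_direct_sum C Ys X \<and> (\<forall>Y \<in> set Ys. local_ring (end_ring C Y)))"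

section \<open>The monoid of isomorphism classes\<close>

definition isomorphic :: "('o, 'm) precat \<Rightarrow> 'o \<Rightarrow> 'o \<Rightarrow> bool" where
  "isomorphic C X Y \<longleftrightarrow> (\<exists>f \<in> carrier (mor C X Y). \<exists>g \<in> carrier (mor C Y X).
     cmp C X Y X g f = idn C X \<and> cmp C Y X Y f g = idn C Y)"

definition iso_class :: "('o, 'm) precat \<Rightarrow> 'o \<Rightarrow> 'o set" where
  "iso_class C X = {Y \<in> obj C. isomorphic C X Y}"

definition iso_monoid :: "('o, 'm) precat \<Rightarrow> 'o set monoid" where
  "iso_monoid C =
     \<lparr>carrier = iso_class C ` obj C,
      mult = (\<lambda>A B. {Z. \<exists>X \<in> A. \<exists>Y \<in> B. is_direct_sum C [X, Y] Z}),
      one = {Z. is_direct_sum C [] Z}\<rparr>"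

section \<open>Flags\<close>

text \<open>Levels are indexed from \<open>0\<close>: \<open>level V l\<close> is \<open>V\<^sub>l\<^sub>+\<^sub>1\<close>. All levels lie in the vector
  space \<open>vspace V\<close>, whose carrier is the largest level \<open>level V 0\<close>.\<close>

record ('k, 'v) flag =
  vspace :: "('k, 'v) module"
  level :: "nat \<Rightarrow> 'v set"

definition is_flag :: "('k, 'r) ring_scheme \<Rightarrow> ('k, 'v) flag \<Rightarrow> bool" where
  "is_flag K V \<longleftrightarrow> vectorspace K (vspace V) \<and> level V 0 = carrier (vspace V) \<and>
     (\<forall>l. subspace K (level V l) (vspace V) \<and> level V (Suc l) \<subseteq> level V l)"

definition finite_depth :: "('k, 'v) flag \<Rightarrow> bool" where
  "finite_depth V \<longleftrightarrow> (\<exists>n. level V n = {\<zero>\<^bsub>vspace V\<^esub>})"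

text \<open>Morphisms are extensional functions on the carrier of the source, so that equality of morphisms
  is equality of HOL functions.\<close>

definition flag_hom ::
  "('k, 'r) ring_scheme \<Rightarrow> ('k, 'v) flag \<Rightarrow> ('k, 'w) flag \<Rightarrow> ('v \<Rightarrow> 'w) set" where
  "flag_hom K V W = {f \<in> extensional (carrier (vspace V)).
     linear_map K (vspace V) (vspace W) f \<and> (\<forall>l. f ` level V l \<subseteq> level W l)}"

definition flag_mor ::
  "('k, 'r) ring_scheme \<Rightarrow> ('k, 'v) flag \<Rightarrow> ('k, 'w) flag \<Rightarrow> ('v \<Rightarrow> 'w) ring" where
  "flag_mor K V W =
     \<lparr>carrier = flag_hom K V W, mult = undefined, one = undefined,
      zero = (\<lambda>v \<in> carrier (vspace V). \<zero>\<^bsub>vspace W\<^esub>),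
      add = (\<lambda>f g. \<lambda>v \<in> carrier (vspace V). f v \<oplus>\<^bsub>vspace W\<^esub> g v)\<rparr>"

text \<open>The type of vectors \<open>'v\<close> plays the role of the universe: the objects are the flags of all
  vector spaces whose underlying set is a subset of \<open>'v\<close>. The category contains a copy of every
  finite-dimensional flag as soon as \<open>lists (carrier K) \<lesssim> (UNIV :: 'v set)\<close>; for smaller types it
  need not be additive.\<close>

definition Flag_fin ::
  "('k, 'r) ring_scheme \<Rightarrow> (('k, 'v) flag, 'v \<Rightarrow> 'v) precat" where
  "Flag_fin K =
     \<lparr>obj = {V. is_flag K V \<and> finite_depth V \<and> vectorspace.fin_dim K (vspace V)},
      mor = flag_mor K,
      idn = (\<lambda>V. \<lambda>v \<in> carrier (vspace V). v),
      cmp = (\<lambda>U V W g f. compose (carrier (vspace U)) g f)\<rparr>"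

definition flag_dims :: "('k, 'r) ring_scheme \<Rightarrow> ('k, 'v) flag \<Rightarrow> nat \<Rightarrow> nat" where
  "flag_dims K V l = vectorspace.dim K ((vspace V)\<lparr>carrier := level V l\<rparr>)"

text \<open>As for flags, the sequence \<open>(m\<^sub>1, m\<^sub>2, \<dots>)\<close> is represented by \<open>m 0, m 1, \<dots>\<close>.\<close>

definition dim_seqs :: "(nat \<Rightarrow> nat) monoid" where
  "dim_seqs =
     \<lparr>carrier = {m. antimono m \<and> (\<exists>n. \<forall>i\<ge>n. m i = 0)},
      mult = (\<lambda>m m' i. m i + m' i),
      one = (\<lambda>i. 0)\<rparr>"

definition flag_sum :: "('k, 'v) flag \<Rightarrow> ('k, 'w) flag \<Rightarrow> ('k, 'v \<times> 'w) flag" where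
  "flag_sum V W = \<lparr>vspace = direct_sum (vspace V) (vspace W), level = (\<lambda>l. level V l \<times> level W l)\<rparr>"

text \<open>The categorical direct sum of two flags is the levelwise one. The levelwise sum has vectors in
  \<open>'v \<times> 'v\<close>, so it is compared with an object of the category by a pair of mutually inverse flag
  morphisms.\<close>

lemma flag_hom_iff:
  assumes "vectorspace K (vspace V)" "vectorspace K (vspace W)"
  shows "f \<in> flag_hom K V W \<longleftrightarrow> f \<in> extensional (carrier (vspace V)) \<and>
    f \<in> carrier (vspace V) \<rightarrow> carrier (vspace W) \<and>
    (\<forall>x\<in>carrier (vspace V). \<forall>y\<in>carrier (vspace V).
       f (x \<oplus>\<^bsub>vspace V\<^esub> y) = f x \<oplus>\<^bsub>vspace W\<^esub> f y) \<and>
    (\<forall>c\<in>carrier K. \<forall>x\<in>carrier (vspace V). f (c \<odot>\<^bsub>vspace V\<^esub> x) = c \<odot>\<^bsub>vspace W\<^esub> f x) \<and>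
    (\<forall>l. \<forall>x\<in>level V l. f x \<in> level W l)"
proof -
  have "module K (vspace V)" "module K (vspace W)"
    using assms by (auto simp: vectorspace_def)
  then have "linear_map K (vspace V) (vspace W) f \<longleftrightarrow> f \<in> module_hom K (vspace V) (vspace W)"
    using assms by (auto simp: linear_map_def mod_hom_def mod_hom_axioms_def)
  then show ?thesis
    unfolding flag_hom_def module_hom_def by blast
qed

lemma is_direct_sum_Flag_fin_iff:
  fixes V W X :: "('k, 'v) flag" and K :: "('k, 'r) ring_scheme"
  assumes V: "V \<in> obj (Flag_fin K)" and W: "W \<in> obj (Flag_fin K)" and X: "X \<in> obj (Flag_fin K)"
  shows "is_direct_sum (Flag_fin K) [V, W] X \<longleftrightarrow>
    (\<exists>f \<in> flag_hom K (flag_sum V W) X. \<exists>g \<in> flag_hom K X (flag_sum V W).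
       (\<forall>u \<in> carrier (vspace (flag_sum V W)). g (f u) = u) \<and> (\<forall>x \<in> carrier (vspace X). f (g x) = x))"
proof -
  have vs: "vectorspace K (vspace V)" "vectorspace K (vspace W)" "vectorspace K (vspace X)"
    using V W X by (auto simp: Flag_fin_def is_flag_def)
  interpret V: vectorspace K "vspace V" by (rule vs)
  interpret W: vectorspace K "vspace W" by (rule vs)
  interpret X: vectorspace K "vspace X" by (rule vs)
  have vsum: "vectorspace K (vspace (flag_sum V W))"
    unfolding flag_sum_def
    by (simp add: vectorspace_def direct_sum_is_module V.module_axioms W.module_axioms V.field_axioms)
  have sub: "subspace K (level V l) (vspace V)" "subspace K (level W l) (vspace W)"
      "subspace K (level X l) (vspace X)" for l
    using V W X by (auto simp: Flag_fin_def is_flag_def)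
  have z: "\<zero>\<^bsub>vspace V\<^esub> \<in> level V l" "\<zero>\<^bsub>vspace W\<^esub> \<in> level W l" "\<zero>\<^bsub>vspace X\<^esub> \<in> level X l" for l
    using sub[of l] by (auto simp: subspace_def submodule_def)
  have cl: "x \<in> level X l \<Longrightarrow> y \<in> level X l \<Longrightarrow> x \<oplus>\<^bsub>vspace X\<^esub> y \<in> level X l" for x y l
    using sub[of l] by (auto simp: subspace_def submodule_def)
  have lc: "x \<in> level V l \<Longrightarrow> x \<in> carrier (vspace V)" "y \<in> level W l \<Longrightarrow> y \<in> carrier (vspace W)"
    "u \<in> level X l \<Longrightarrow> u \<in> carrier (vspace X)" for x y u l
    using sub[of l] by (auto simp: subspace_def submodule_def)
  note hom = flag_hom_iff[OF vs(1) vs(3)] flag_hom_iff[OF vs(2) vs(3)] flag_hom_iff[OF vs(3) vs(1)]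
    flag_hom_iff[OF vs(3) vs(2)] flag_hom_iff[OF vs(3) vs(3)] flag_hom_iff[OF vsum vs(3)]
    flag_hom_iff[OF vs(3) vsum]
  have C [simp]: "mor (Flag_fin K) = flag_mor K"
    "idn (Flag_fin K) = (\<lambda>V :: ('k, 'v) flag. \<lambda>v \<in> carrier (vspace V). v)"
    "cmp (Flag_fin K) = (\<lambda>U V W g f. compose (carrier (vspace (U :: ('k, 'v) flag))) g f)"
    by (simp_all add: Flag_fin_def)
  have M [simp]: "carrier (flag_mor K A B) = flag_hom K A B"
      "\<zero>\<^bsub>flag_mor K A B\<^esub> = (\<lambda>v \<in> carrier (vspace A). \<zero>\<^bsub>vspace B\<^esub>)"
      "f \<oplus>\<^bsub>flag_mor K A B\<^esub> g = (\<lambda>v \<in> carrier (vspace A). f v \<oplus>\<^bsub>vspace B\<^esub> g v)"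
    for A B :: "('k, 'v) flag" and f g
    by (simp_all add: flag_mor_def)
  have comm: "abelian_monoid (flag_mor K X X)"
  proof (rule abelian_monoidI, goal_cases)
    case (1 f g)
    then show ?case by (auto simp: hom cl lc X.a_ac X.smult_r_distr Pi_iff)
  next
    case 2 then show ?case by (auto simp: hom z dest: lc)
  next
    case (3 f g h)
    then show ?case by (auto simp: hom Pi_iff X.a_assoc fun_eq_iff)
  next
    case (4 f)
    then show ?case by (auto simp: hom Pi_iff extensional_def fun_eq_iff)
  next
    case (5 f g)
    then show ?case by (auto simp: hom Pi_iff X.a_comm fun_eq_iff)
  qed
  interpret E: abelian_monoid "flag_mor K X X" by (rule comm)
  have sum2: "(\<Oplus>\<^bsub>flag_mor K X X\<^esub>i\<in>{0 :: nat, 1}. a i) = a 0 \<oplus>\<^bsub>flag_mor K X X\<^esub> a 1"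
    if "a 0 \<in> flag_hom K X X" "a 1 \<in> flag_hom K X X" for a
    using that E.r_zero[of "a 1"] by (simp add: E.finsum_insert del: M(2,3))
  have S [simp]: "carrier (vspace (flag_sum V W)) = carrier (vspace V) \<times> carrier (vspace W)"
      "a \<oplus>\<^bsub>vspace (flag_sum V W)\<^esub> b = (fst a \<oplus>\<^bsub>vspace V\<^esub> fst b, snd a \<oplus>\<^bsub>vspace W\<^esub> snd b)"
      "c \<odot>\<^bsub>vspace (flag_sum V W)\<^esub> a = (c \<odot>\<^bsub>vspace V\<^esub> fst a, c \<odot>\<^bsub>vspace W\<^esub> snd a)"
      "level (flag_sum V W) l = level V l \<times> level W l" for a b c l
    by (simp_all add: flag_sum_def direct_sum_def)
  have all2: "(\<forall>i<Suc (Suc 0). P i) \<longleftrightarrow> P 0 \<and> P 1" for P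
    by (auto simp: less_Suc_eq)
  have l2: "{..<Suc (Suc 0)} = {0, 1}" by auto
  show ?thesis
  proof
    assume "is_direct_sum (Flag_fin K) [V, W] X"
    then obtain \<iota> \<pi> where b: "is_biproduct (Flag_fin K) [V, W] X \<iota> \<pi>"
      by (auto simp: is_direct_sum_def)
    have h: "\<iota> 0 \<in> flag_hom K V X" "\<iota> 1 \<in> flag_hom K W X" "\<pi> 0 \<in> flag_hom K X V" "\<pi> 1 \<in> flag_hom K X W"
      using b by (auto simp: is_biproduct_def all2)
    have c: "compose (carrier (vspace V)) (\<pi> 0) (\<iota> 0) = (\<lambda>v \<in> carrier (vspace V). v)"
      "compose (carrier (vspace V)) (\<pi> 1) (\<iota> 0) = (\<lambda>v \<in> carrier (vspace V). \<zero>\<^bsub>vspace W\<^esub>)"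
      "compose (carrier (vspace W)) (\<pi> 0) (\<iota> 1) = (\<lambda>v \<in> carrier (vspace W). \<zero>\<^bsub>vspace V\<^esub>)"
      "compose (carrier (vspace W)) (\<pi> 1) (\<iota> 1) = (\<lambda>v \<in> carrier (vspace W). v)"
      using b by (auto simp: is_biproduct_def all2)
    have p: "compose (carrier (vspace X)) (\<iota> 0) (\<pi> 0) \<in> flag_hom K X X"
      "compose (carrier (vspace X)) (\<iota> 1) (\<pi> 1) \<in> flag_hom K X X"
      using h by (auto simp: hom compose_def Pi_iff lc)
    have "(\<Oplus>\<^bsub>flag_mor K X X\<^esub>i\<in>{0, 1}. compose (carrier (vspace X)) (\<iota> i) (\<pi> i))
      = (\<lambda>v \<in> carrier (vspace X). v)"
      using b by (simp add: is_biproduct_def l2)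
    then have s: "(\<lambda>x \<in> carrier (vspace X). \<iota> 0 (\<pi> 0 x) \<oplus>\<^bsub>vspace X\<^esub> \<iota> 1 (\<pi> 1 x))
      = (\<lambda>v \<in> carrier (vspace X). v)"
      using p sum2[of "\<lambda>i. compose (carrier (vspace X)) (\<iota> i) (\<pi> i)"]
      by (simp add: compose_def del: E.finsum_insert cong: restrict_cong)
    define f where "f = (\<lambda>u \<in> carrier (vspace V) \<times> carrier (vspace W).
      \<iota> 0 (fst u) \<oplus>\<^bsub>vspace X\<^esub> \<iota> 1 (snd u))"
    define g where "g = (\<lambda>x \<in> carrier (vspace X). (\<pi> 0 x, \<pi> 1 x))"
    have c': "v \<in> carrier (vspace V) \<Longrightarrow> \<pi> 0 (\<iota> 0 v) = v"
        "v \<in> carrier (vspace V) \<Longrightarrow> \<pi> 1 (\<iota> 0 v) = \<zero>\<^bsub>vspace W\<^esub>"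
        "w \<in> carrier (vspace W) \<Longrightarrow> \<pi> 0 (\<iota> 1 w) = \<zero>\<^bsub>vspace V\<^esub>"
        "w \<in> carrier (vspace W) \<Longrightarrow> \<pi> 1 (\<iota> 1 w) = w" for v w
      using c by (auto simp: compose_def fun_eq_iff restrict_def split: if_splits)
    have s': "x \<in> carrier (vspace X) \<Longrightarrow> \<iota> 0 (\<pi> 0 x) \<oplus>\<^bsub>vspace X\<^esub> \<iota> 1 (\<pi> 1 x) = x" for x
      using fun_cong[OF s, of x] by simp
    have "f \<in> flag_hom K (flag_sum V W) X"
      using h by (auto simp: hom f_def Pi_iff lc cl X.a_ac X.smult_r_distr)
    moreover have "g \<in> flag_hom K X (flag_sum V W)"
      using h by (auto simp: hom g_def Pi_iff lc)
    moreover have "\<forall>u \<in> carrier (vspace (flag_sum V W)). g (f u) = u"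
      using h c' by (auto simp: hom f_def g_def Pi_iff)
    moreover have "\<forall>x \<in> carrier (vspace X). f (g x) = x"
      using h s' by (auto simp: hom f_def g_def Pi_iff)
    ultimately show "\<exists>f \<in> flag_hom K (flag_sum V W) X. \<exists>g \<in> flag_hom K X (flag_sum V W).
       (\<forall>u \<in> carrier (vspace (flag_sum V W)). g (f u) = u) \<and> (\<forall>x \<in> carrier (vspace X). f (g x) = x)"
      by blast
  next
    assume "\<exists>f \<in> flag_hom K (flag_sum V W) X. \<exists>g \<in> flag_hom K X (flag_sum V W).
       (\<forall>u \<in> carrier (vspace (flag_sum V W)). g (f u) = u) \<and> (\<forall>x \<in> carrier (vspace X). f (g x) = x)"
    then obtain f g where f: "f \<in> flag_hom K (flag_sum V W) X" and g: "g \<in> flag_hom K X (flag_sum V W)"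
      and gf: "\<And>v w. \<lbrakk>v \<in> carrier (vspace V); w \<in> carrier (vspace W)\<rbrakk> \<Longrightarrow> g (f (v, w)) = (v, w)"
      and fg: "\<And>x. x \<in> carrier (vspace X) \<Longrightarrow> f (g x) = x"
      by fastforce
    have gc: "fst (g x) \<in> carrier (vspace V)" "snd (g x) \<in> carrier (vspace W)"
      if "x \<in> carrier (vspace X)" for x
      using g that by (auto simp: hom Pi_iff mem_Times_iff)
    have gl: "fst (g x) \<in> level V l" "snd (g x) \<in> level W l" if "x \<in> level X l" for x l
      using g that by (auto simp: hom mem_Times_iff)
    have fa: "f (v, w) \<oplus>\<^bsub>vspace X\<^esub> f (v', w') = f (v \<oplus>\<^bsub>vspace V\<^esub> v', w \<oplus>\<^bsub>vspace W\<^esub> w')"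
      if "v \<in> carrier (vspace V)" "v' \<in> carrier (vspace V)"
        "w \<in> carrier (vspace W)" "w' \<in> carrier (vspace W)" for v v' w w'
      using f that by (simp add: hom)
    have fs: "c \<odot>\<^bsub>vspace X\<^esub> f (v, w) = f (c \<odot>\<^bsub>vspace V\<^esub> v, c \<odot>\<^bsub>vspace W\<^esub> w)"
      if "c \<in> carrier K" "v \<in> carrier (vspace V)" "w \<in> carrier (vspace W)" for c v w
      using f that by (simp add: hom)
    have fc: "f (v, w) \<in> carrier (vspace X)"
      if "v \<in> carrier (vspace V)" "w \<in> carrier (vspace W)" for v w
      using f that by (auto simp: hom Pi_iff)
    have fl: "f (v, w) \<in> level X l" if "v \<in> level V l" "w \<in> level W l" for v w l
      using f that by (auto simp: hom)
    define \<iota> where "\<iota> = (\<lambda>i :: nat. if i = 0 then (\<lambda>v \<in> carrier (vspace V). f (v, \<zero>\<^bsub>vspace W\<^esub>))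
      else (\<lambda>w \<in> carrier (vspace W). f (\<zero>\<^bsub>vspace V\<^esub>, w)))"
    define \<pi> where "\<pi> = (\<lambda>i :: nat. if i = 0 then (\<lambda>x \<in> carrier (vspace X). fst (g x))
      else (\<lambda>x \<in> carrier (vspace X). snd (g x)))"
    have h: "\<iota> 0 \<in> flag_hom K V X" "\<iota> (Suc 0) \<in> flag_hom K W X"
      by (auto simp: hom \<iota>_def lc fa fs fc fl z)
    have h': "\<pi> 0 \<in> flag_hom K X V" "\<pi> (Suc 0) \<in> flag_hom K X W"
      using g by (auto simp: hom \<pi>_def lc gc gl)
    have p: "compose (carrier (vspace X)) (\<iota> 0) (\<pi> 0) \<in> flag_hom K X X"
      "compose (carrier (vspace X)) (\<iota> (Suc 0)) (\<pi> (Suc 0)) \<in> flag_hom K X X"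
      using h h' by (auto simp: hom compose_def Pi_iff lc)
    have "(\<Oplus>\<^bsub>flag_mor K X X\<^esub>i\<in>{0, 1}. compose (carrier (vspace X)) (\<iota> i) (\<pi> i))
      = (\<lambda>v \<in> carrier (vspace X). v)"
      using p sum2[of "\<lambda>i. compose (carrier (vspace X)) (\<iota> i) (\<pi> i)"]
      by (auto simp del: E.finsum_insert simp: compose_def \<iota>_def \<pi>_def gc fa fg fun_eq_iff restrict_def)
    then have "is_biproduct (Flag_fin K) [V, W] X \<iota> \<pi>"
      using V W X h h'
      by (auto simp: is_biproduct_def all2 l2)
        (auto simp: compose_def \<iota>_def \<pi>_def fc gf fun_eq_iff restrict_def)
    then show "is_direct_sum (Flag_fin K) [V, W] X"
      by (auto simp: is_direct_sum_def)
  qed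
qed

end

theory Submission
  imports Defs
begin

text \<open>Let \<open>v\<close> be a nonzero vector in the last nonzero level of a flag \<open>V\<close>, and let \<open>H\<close> be the kernel of a
  linear functional that is \<open>1\<close> at \<open>v\<close>. Since \<open>v\<close> lies in every nonzero level, \<open>V\<close> is the direct sum of
  the flags induced on the line of \<open>v\<close> and on \<open>H\<close>. By induction on the dimension, flags with the same
  dimension sequence are isomorphic, and each flag is a direct sum of lines. The endomorphism ring
  of a line is the field, hence local. Every admissible sequence is a sum of sequences of lines.\<close>

section \<open>Linear algebra\<close>

text \<open>The complement of the line has to split every level. For a vector \<open>v\<close>
  outside the last nonzero level this can fail: an \<open>x\<close> in a deeper level with
  \<open>h x\<close> nonzero has its component along \<open>v\<close> outside that level. For
  \<open>v\<close> in the last nonzero level, subtracting \<open>h x\<close> times \<open>v\<close>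
  never leaves a level that contains \<open>x\<close>, so no basis adapted to all levels at once is
  required. The other obstacle is that vectors live in types. A levelwise sum has its vectors in a
  product type and a line has them in the field, so isomorphism of flags is set up between different
  types, and the classification is proved in this generality. The universe enters afterwards: as
  \<open>lists (carrier K)\<close> embeds in \<open>'v\<close>, the type \<open>'v\<close> is
  infinite and contains copies of the field and of \<open>'v \<times> 'v\<close>. Once the dimension
  sequence is known to be a complete invariant, isomorphism, direct sums and zero objects are all
  decided by sequences. Read as a partition, the sequence of a flag is conjugate to the list of
  lengths of its lines.\<close>

lemma (in vectorspace) subspace_fin_dim:
  assumes fd: "fin_dim" and W: "subspace K W V"
  shows "vectorspace.fin_dim K (vs W)" and "vectorspace.dim K (vs W) \<le> dim"
proof -
  have sub: "submodule K W V" using W by simp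
  then have WV: "W \<subseteq> carrier V" by (simp add: submodule_def)
  interpret W: vectorspace K "vs W" using W by (rule subspace_is_vs)
  have li: "W.lin_dep A = lin_dep A" if "A \<subseteq> W" for A
    using span_li_not_depend(2)[OF that sub] .
  \<comment> \<open>Independence in \<open>W\<close> agrees with independence in \<open>V\<close>,
    so the dimension of \<open>V\<close> bounds all independent subsets of \<open>W\<close>; hence a
    maximal one exists, and it is a basis.\<close>
  have bound: "finite A \<and> card A \<le> dim" if "A \<subseteq> W \<and> \<not> W.lin_dep A" for A
    using li_le_dim[OF fd, of A] that li[of A] WV by auto
  have "\<not> W.lin_dep {}" by (simp add: W.lin_dep_def)
  then obtain A where A: "finite A" "maximal A (\<lambda>A. A \<subseteq> W \<and> \<not> W.lin_dep A)"
    using maximal_exists[of "\<lambda>A. A \<subseteq> W \<and> \<not> W.lin_dep A" dim "{}"] bound by auto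
  then have b: "W.basis A" using W.max_li_is_basis by simp
  then show "W.fin_dim" using A(1) by (auto simp: W.fin_dim_def W.basis_def)
  have "W.dim = card A" using A(1) b by (rule W.dim_basis)
  also have "\<dots> \<le> dim" using A(2) bound by (simp add: maximal_def)
  finally show "W.dim \<le> dim" .
qed

lemma linear_mapI:
  assumes "vectorspace K V" "vectorspace K W" "\<And>x. x \<in> carrier V \<Longrightarrow> f x \<in> carrier W"
    "\<And>x y. \<lbrakk>x \<in> carrier V; y \<in> carrier V\<rbrakk> \<Longrightarrow> f (x \<oplus>\<^bsub>V\<^esub> y) = f x \<oplus>\<^bsub>W\<^esub> f y"
    "\<And>c x. \<lbrakk>c \<in> carrier K; x \<in> carrier V\<rbrakk> \<Longrightarrow> f (c \<odot>\<^bsub>V\<^esub> x) = c \<odot>\<^bsub>W\<^esub> f x"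
  shows "linear_map K V W f"
  using assms by (auto simp: linear_map_def mod_hom_def mod_hom_axioms_def module_hom_def vectorspace_def)

lemma direct_sum_simps [simp]:
  "carrier (direct_sum V W) = carrier V \<times> carrier W"
  "\<zero>\<^bsub>direct_sum V W\<^esub> = (\<zero>\<^bsub>V\<^esub>, \<zero>\<^bsub>W\<^esub>)"
  "a \<oplus>\<^bsub>direct_sum V W\<^esub> b = (fst a \<oplus>\<^bsub>V\<^esub> fst b, snd a \<oplus>\<^bsub>W\<^esub> snd b)"
  "c \<odot>\<^bsub>direct_sum V W\<^esub> a = (c \<odot>\<^bsub>V\<^esub> fst a, c \<odot>\<^bsub>W\<^esub> snd a)"
  by (simp_all add: direct_sum_def)

lemma direct_sum_fin_dim:
  assumes V: "vectorspace K V" and W: "vectorspace K W"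
    and fd: "vectorspace.fin_dim K V" "vectorspace.fin_dim K W"
  shows "vectorspace.fin_dim K (direct_sum V W)"
proof -
  interpret V: vectorspace K V by (rule V)
  interpret W: vectorspace K W by (rule W)
  interpret S: vectorspace K "direct_sum V W" using V W by (rule direct_sum_is_vs)
  obtain A where A: "finite A" "A \<subseteq> carrier V" "V.span A = carrier V"
    using fd(1) by (auto simp: V.fin_dim_def)
  obtain B where B: "finite B" "B \<subseteq> carrier W" "W.span B = carrier W"
    using fd(2) by (auto simp: W.fin_dim_def)
  \<comment> \<open>The two spanning sets, placed on the axes. The span of \<open>?C\<close>
    contains each axis because its preimage under the inclusion of the axis is a submodule
    containing \<open>A\<close> or \<open>B\<close>.\<close>
  let ?C = "(\<lambda>v. (v, \<zero>\<^bsub>W\<^esub>)) ` A \<union> (\<lambda>w. (\<zero>\<^bsub>V\<^esub>, w)) ` B"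
  have C: "?C \<subseteq> carrier (direct_sum V W)" using A B by auto
  have sm: "submodule K (S.span ?C) (direct_sum V W)" using C by (rule S.span_is_submodule)
  have inC: "x \<in> ?C \<Longrightarrow> x \<in> S.span ?C" for x using S.in_own_span[OF C] by blast
  note cl = submodule.m_closed[OF sm] submodule.smult_closed[OF sm] submodule.zero_closed[OF sm]
  have "submodule K {v \<in> carrier V. (v, \<zero>\<^bsub>W\<^esub>) \<in> S.span ?C} V"
  proof (rule submodule.intro, goal_cases)
    case 3 then show ?case using cl(1) by fastforce
  next
    case 4 then show ?case using cl(3) by simp
  next
    case 5 then show ?case using cl(2) by fastforce
  qed (auto intro: V.module_axioms)
  then have "V.span A \<subseteq> {v \<in> carrier V. (v, \<zero>\<^bsub>W\<^esub>) \<in> S.span ?C}"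
    using A inC by (intro V.span_is_subset) auto
  then have 1: "v \<in> carrier V \<Longrightarrow> (v, \<zero>\<^bsub>W\<^esub>) \<in> S.span ?C" for v using A by auto
  have "submodule K {w \<in> carrier W. (\<zero>\<^bsub>V\<^esub>, w) \<in> S.span ?C} W"
  proof (rule submodule.intro, goal_cases)
    case 3 then show ?case using cl(1) by fastforce
  next
    case 4 then show ?case using cl(3) by simp
  next
    case 5 then show ?case using cl(2) by fastforce
  qed (auto intro: W.module_axioms)
  then have "W.span B \<subseteq> {w \<in> carrier W. (\<zero>\<^bsub>V\<^esub>, w) \<in> S.span ?C}"
    using B inC by (intro W.span_is_subset) auto
  then have 2: "w \<in> carrier W \<Longrightarrow> (\<zero>\<^bsub>V\<^esub>, w) \<in> S.span ?C" for w using B by auto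
  have "(v, w) \<in> S.span ?C" if "v \<in> carrier V" "w \<in> carrier W" for v w
    using cl(1)[OF 1[OF that(1)] 2[OF that(2)]] that by simp
  then have "S.span ?C = carrier (direct_sum V W)"
    using S.span_is_subset2[OF C] by auto
  then show ?thesis
    unfolding S.fin_dim_def using A(1) B(1) C by (intro exI[of _ ?C]) auto
qed

text \<open>Rank-nullity for the second projection, whose kernel is a copy of the first
  summand.\<close>

lemma direct_sum_dim:
  assumes V: "vectorspace K V" and W: "vectorspace K W"
    and fd: "vectorspace.fin_dim K V" "vectorspace.fin_dim K W"
  shows "vectorspace.dim K (direct_sum V W) = vectorspace.dim K V + vectorspace.dim K W"
proof -
  interpret V: vectorspace K V by (rule V)
  interpret W: vectorspace K W by (rule W)
  interpret S: vectorspace K "direct_sum V W" using V W by (rule direct_sum_is_vs)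
  interpret p: linear_map K "direct_sum V W" W snd
    by (rule linear_mapI) (auto intro: S.vectorspace_axioms W)
  have ker: "p.kerT = carrier V \<times> {\<zero>\<^bsub>W\<^esub>}" by (auto simp: p.ker_def)
  have im: "p.imT = carrier W" by (auto simp: p.im_def image_iff intro: exI[of _ "\<zero>\<^bsub>V\<^esub>"])
  interpret k: vectorspace K "S.vs p.kerT"
    by (rule S.subspace_is_vs[OF p.kerT_is_subspace])
  interpret i: linear_map K V "S.vs p.kerT" "\<lambda>v. (v, \<zero>\<^bsub>W\<^esub>)"
    by (rule linear_mapI) (use k.vectorspace_axioms V in \<open>auto simp: ker\<close>)
  have "V.dim = k.dim"
    by (rule i.dim_eq[OF fd(1)]) (auto simp: ker inj_on_def)
  moreover have "W.vs p.imT = W" by (simp add: im)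
  ultimately show ?thesis
    using p.rank_nullity[OF direct_sum_fin_dim[OF assms]] by simp
qed

text \<open>The functional is a coordinate, with respect to some basis, that does not vanish at
  \<open>v\<close>, divided by its value there.\<close>

lemma (in vectorspace) exists_linear_functional:
  assumes fd: "fin_dim" and v: "v \<in> carrier V" "v \<noteq> \<zero>\<^bsub>V\<^esub>"
  obtains h where "\<And>x. x \<in> carrier V \<Longrightarrow> h x \<in> carrier K"
    "\<And>x y. \<lbrakk>x \<in> carrier V; y \<in> carrier V\<rbrakk> \<Longrightarrow> h (x \<oplus>\<^bsub>V\<^esub> y) = h x \<oplus>\<^bsub>K\<^esub> h y"
    "\<And>c x. \<lbrakk>c \<in> carrier K; x \<in> carrier V\<rbrakk> \<Longrightarrow> h (c \<odot>\<^bsub>V\<^esub> x) = c \<otimes>\<^bsub>K\<^esub> h x"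
    "h v = \<one>\<^bsub>K\<^esub>"
proof -
  obtain B where B: "finite B" "basis B" using finite_basis_exists[OF fd] by blast
  then have BV: "B \<subseteq> carrier V" by (simp add: basis_def)
  \<comment> \<open>The coordinate vector of \<open>x\<close>. Being extensional outside
    \<open>B\<close> makes it unique, and uniqueness gives its linearity.\<close>
  define r where "r x = (THE a. a \<in> B \<rightarrow>\<^sub>E carrier K \<and> lincomb a B = x)" for x
  have ex1: "\<exists>!a. a \<in> B \<rightarrow>\<^sub>E carrier K \<and> lincomb a B = x" if "x \<in> carrier V" for x
    using basis_criterion[OF B(1) BV] B(2) that by blast
  have r: "r x \<in> B \<rightarrow>\<^sub>E carrier K" "lincomb (r x) B = x" if "x \<in> carrier V" for x
    using theI'[OF ex1[OF that]] by (simp_all add: r_def)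
  have req: "r x = a" if "a \<in> B \<rightarrow>\<^sub>E carrier K" "lincomb a B = x" for a x
  proof -
    have "x \<in> carrier V" using that BV lincomb_closed[OF BV, of a] by auto
    then show ?thesis using ex1 r that by blast
  qed
  interpret m: mod_hom K "func_space B" V "\<lambda>a. lincomb a B"
    by (rule lincomb_is_mod_hom[OF B(1) BV])
  have radd: "r (x \<oplus>\<^bsub>V\<^esub> y) = (\<lambda>b\<in>B. r x b \<oplus>\<^bsub>K\<^esub> r y b)" if "x \<in> carrier V" "y \<in> carrier V" for x y
  proof (rule req)
    show "lincomb (\<lambda>b\<in>B. r x b \<oplus>\<^bsub>K\<^esub> r y b) B = x \<oplus>\<^bsub>V\<^esub> y"
      using m.f_add[of "r x" "r y"] r[OF that(1)] r[OF that(2)] by (simp add: func_space_def)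
  qed (use r[OF that(1)] r[OF that(2)] in \<open>auto simp: PiE_iff\<close>)
  have rsmult: "r (c \<odot>\<^bsub>V\<^esub> x) = (\<lambda>b\<in>B. c \<otimes>\<^bsub>K\<^esub> r x b)" if "c \<in> carrier K" "x \<in> carrier V" for c x
  proof (rule req)
    show "lincomb (\<lambda>b\<in>B. c \<otimes>\<^bsub>K\<^esub> r x b) B = c \<odot>\<^bsub>V\<^esub> x"
      using m.f_smult[of c "r x"] r[OF that(2)] that by (simp add: func_space_def)
  qed (use r[OF that(2)] that in \<open>auto simp: PiE_iff\<close>)
  have "\<exists>b\<in>B. r v b \<noteq> \<zero>\<^bsub>K\<^esub>"
  proof (rule ccontr)
    assume "\<not> (\<exists>b\<in>B. r v b \<noteq> \<zero>\<^bsub>K\<^esub>)"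
    then have "lincomb (r v) B = \<zero>\<^bsub>V\<^esub>" by (intro lincomb_zero BV) auto
    then show False using r[OF v(1)] v(2) by simp
  qed
  then obtain b where b: "b \<in> B" "r v b \<noteq> \<zero>\<^bsub>K\<^esub>" by blast
  have rb: "r x b \<in> carrier K" if "x \<in> carrier V" for x using r[OF that] b(1) by auto
  let ?c = "inv\<^bsub>K\<^esub> r v b"
  have c: "?c \<in> carrier K" "?c \<otimes>\<^bsub>K\<^esub> r v b = \<one>\<^bsub>K\<^esub>"
    using b(2) rb[OF v(1)] by (auto simp: field_Units)
  show ?thesis
  proof (rule that[of "\<lambda>x. ?c \<otimes>\<^bsub>K\<^esub> r x b"])
    show "?c \<otimes>\<^bsub>K\<^esub> r (x \<oplus>\<^bsub>V\<^esub> y) b = ?c \<otimes>\<^bsub>K\<^esub> r x b \<oplus>\<^bsub>K\<^esub> ?c \<otimes>\<^bsub>K\<^esub> r y b"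
      if "x \<in> carrier V" "y \<in> carrier V" for x y
      using that b(1) c(1) rb by (simp add: radd R.r_distr)
    show "?c \<otimes>\<^bsub>K\<^esub> r (d \<odot>\<^bsub>V\<^esub> x) b = d \<otimes>\<^bsub>K\<^esub> (?c \<otimes>\<^bsub>K\<^esub> r x b)"
      if "d \<in> carrier K" "x \<in> carrier V" for d x
      using that b(1) c(1) rb by (simp add: rsmult R.m_lcomm)
  qed (use c rb in auto)
qed

section \<open>Flags\<close>

definition fin_flag :: "('k, 'r) ring_scheme \<Rightarrow> ('k, 'v) flag \<Rightarrow> bool" where
  "fin_flag K V \<longleftrightarrow> is_flag K V \<and> finite_depth V \<and> vectorspace.fin_dim K (vspace V)"

text \<open>\<open>isomorphic\<close> compares objects of one category, hence of one vector type.
  Here the vector types of \<open>V\<close> and \<open>W\<close> may differ, so lines, levelwise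
  sums and flags in the universe can be compared with each other. For a levelwise sum and an object
  \<open>X\<close> it is the right-hand side of \<open>is_direct_sum_Flag_fin_iff\<close>.\<close>

definition flag_iso :: "('k, 'r) ring_scheme \<Rightarrow> ('k, 'v) flag \<Rightarrow> ('k, 'w) flag \<Rightarrow> bool" where
  "flag_iso K V W \<longleftrightarrow> (\<exists>f \<in> flag_hom K V W. \<exists>g \<in> flag_hom K W V.
     (\<forall>v \<in> carrier (vspace V). g (f v) = v) \<and> (\<forall>w \<in> carrier (vspace W). f (g w) = w))"

lemma obj_Flag_fin: "obj (Flag_fin K) = Collect (fin_flag K)"
  by (auto simp: Flag_fin_def fin_flag_def)

lemma fin_flag_vs:
  assumes "fin_flag K V"
  shows "vectorspace K (vspace V)" and "vectorspace.fin_dim K (vspace V)"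
    and "subspace K (level V l) (vspace V)"
  using assms by (auto simp: fin_flag_def is_flag_def)

lemma fin_flag_level:
  assumes "fin_flag K V"
  shows "level V 0 = carrier (vspace V)" and "level V l \<subseteq> carrier (vspace V)"
    and "\<zero>\<^bsub>vspace V\<^esub> \<in> level V l"
    and "\<lbrakk>x \<in> level V l; y \<in> level V l\<rbrakk> \<Longrightarrow> x \<oplus>\<^bsub>vspace V\<^esub> y \<in> level V l"
    and "\<lbrakk>c \<in> carrier K; x \<in> level V l\<rbrakk> \<Longrightarrow> c \<odot>\<^bsub>vspace V\<^esub> x \<in> level V l"
    and "l \<le> m \<Longrightarrow> level V m \<subseteq> level V l"
proof -
  show "level V 0 = carrier (vspace V)" using assms by (simp add: fin_flag_def is_flag_def)
  have s: "submodule K (level V l) (vspace V)"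
    using fin_flag_vs(3)[OF assms] by (simp add: subspace_def)
  then show "level V l \<subseteq> carrier (vspace V)" "\<zero>\<^bsub>vspace V\<^esub> \<in> level V l"
    "\<lbrakk>x \<in> level V l; y \<in> level V l\<rbrakk> \<Longrightarrow> x \<oplus>\<^bsub>vspace V\<^esub> y \<in> level V l"
    "\<lbrakk>c \<in> carrier K; x \<in> level V l\<rbrakk> \<Longrightarrow> c \<odot>\<^bsub>vspace V\<^esub> x \<in> level V l"
    by (auto simp: submodule_def)
  have "level V (Suc l) \<subseteq> level V l" for l using assms by (simp add: fin_flag_def is_flag_def)
  then show "l \<le> m \<Longrightarrow> level V m \<subseteq> level V l" by (rule lift_Suc_antimono_le)
qed

lemma fin_flag_level_fin_dim:
  assumes "fin_flag K V"
  shows "vectorspace K (vspace V\<lparr>carrier := level V l\<rparr>)"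
    and "vectorspace.fin_dim K (vspace V\<lparr>carrier := level V l\<rparr>)"
  using vectorspace.subspace_fin_dim(1)[OF fin_flag_vs[OF assms]]
    vectorspace.subspace_is_vs[OF fin_flag_vs(1,3)[OF assms]] by auto

lemma flag_dims_0:
  assumes "fin_flag K V"
  shows "flag_dims K V 0 = vectorspace.dim K (vspace V)"
  by (simp add: flag_dims_def fin_flag_level(1)[OF assms])

lemma (in vectorspace) dim_eq_0_iff:
  assumes "fin_dim"
  shows "dim = 0 \<longleftrightarrow> carrier V = {\<zero>\<^bsub>V\<^esub>}"
proof
  assume "dim = 0"
  moreover obtain B where B: "finite B" "basis B" using finite_basis_exists[OF assms] by blast
  ultimately have "B = {}" using dim_basis by fastforce
  then show "carrier V = {\<zero>\<^bsub>V\<^esub>}" using B span_empty by (simp add: basis_def)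
next
  assume "carrier V = {\<zero>\<^bsub>V\<^esub>}"
  then show "dim = 0" using span_zero span_closed[of "{\<zero>\<^bsub>V\<^esub>}"] by (intro dim0I) auto
qed

lemma flag_dims_eq_0_iff:
  assumes "fin_flag K V"
  shows "flag_dims K V l = 0 \<longleftrightarrow> level V l = {\<zero>\<^bsub>vspace V\<^esub>}"
  using vectorspace.dim_eq_0_iff[OF fin_flag_level_fin_dim[OF assms, of l]] by (simp add: flag_dims_def)

lemma flag_dims_closed:
  assumes V: "fin_flag K V"
  shows "flag_dims K V \<in> carrier dim_seqs"
proof -
  have "flag_dims K V (Suc l) \<le> flag_dims K V l" for l
  proof -
    interpret L: vectorspace K "vspace V\<lparr>carrier := level V l\<rparr>" by (rule fin_flag_level_fin_dim[OF V])
    have "subspace K (level V (Suc l)) (vspace V\<lparr>carrier := level V l\<rparr>)"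
      unfolding subspace_def submodule_def
      using L.vectorspace_axioms L.module_axioms fin_flag_level[OF V] by auto
    from L.subspace_fin_dim(2)[OF fin_flag_level_fin_dim(2)[OF V] this]
    show ?thesis by (simp add: flag_dims_def)
  qed
  then have "antimono (flag_dims K V)" by (rule antimonoI[OF lift_Suc_antimono_le])
  moreover obtain n where n: "level V n = {\<zero>\<^bsub>vspace V\<^esub>}"
    using V by (auto simp: fin_flag_def finite_depth_def)
  have "flag_dims K V i = 0" if "i \<ge> n" for i
    using fin_flag_level(3)[OF V, of i] fin_flag_level(6)[OF V that] n
    by (auto simp: flag_dims_eq_0_iff[OF V])
  ultimately show ?thesis by (auto simp: dim_seqs_def)
qed

section \<open>Isomorphisms of flags\<close>

text \<open>The levels must be mapped onto each other: a bijective morphism that sends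
  \<open>level V l\<close> properly into \<open>level W l\<close> has no inverse among the flag
  morphisms. At level 0 this condition supplies surjectivity.\<close>

lemma flag_isoI:
  assumes V: "fin_flag K V" and W: "fin_flag K W"
    and cl: "\<And>x. x \<in> carrier (vspace V) \<Longrightarrow> f x \<in> carrier (vspace W)"
    and add: "\<And>x y. \<lbrakk>x \<in> carrier (vspace V); y \<in> carrier (vspace V)\<rbrakk>
        \<Longrightarrow> f (x \<oplus>\<^bsub>vspace V\<^esub> y) = f x \<oplus>\<^bsub>vspace W\<^esub> f y"
    and smult: "\<And>c x. \<lbrakk>c \<in> carrier K; x \<in> carrier (vspace V)\<rbrakk>
        \<Longrightarrow> f (c \<odot>\<^bsub>vspace V\<^esub> x) = c \<odot>\<^bsub>vspace W\<^esub> f x"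
    and inj: "inj_on f (carrier (vspace V))"
    and lev: "\<And>l. f ` level V l = level W l"
  shows "flag_iso K V W"
proof -
  interpret V: vectorspace K "vspace V" by (rule fin_flag_vs[OF V])
  note vs = fin_flag_vs(1)[OF V] fin_flag_vs(1)[OF W]
  let ?f = "restrict f (carrier (vspace V))"
  let ?g = "\<lambda>w \<in> carrier (vspace W). inv_into (carrier (vspace V)) f w"
  have im: "f ` carrier (vspace V) = carrier (vspace W)"
    using lev[of 0] fin_flag_level(1)[OF V] fin_flag_level(1)[OF W] by simp
  have gf: "inv_into (carrier (vspace V)) f (f x) = x" if "x \<in> carrier (vspace V)" for x
    using inj that by (rule inv_into_f_f)
  note lc = fin_flag_level(2)[OF V, THEN subsetD] fin_flag_level(2)[OF W, THEN subsetD]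
  have f: "?f \<in> flag_hom K V W"
    unfolding flag_hom_iff[OF vs]
  proof (intro conjI ballI allI)
    fix l x assume x: "x \<in> level V l"
    then show "?f x \<in> level W l" using lev[of l] lc(1)[OF x] by auto
  qed (use cl add smult in auto)
  have g: "?g \<in> flag_hom K W V"
    unfolding flag_hom_iff[OF vs(2,1)]
  proof (intro conjI ballI allI)
    fix x y assume "x \<in> carrier (vspace W)" "y \<in> carrier (vspace W)"
    then obtain a b where "x = f a" "y = f b" "a \<in> carrier (vspace V)" "b \<in> carrier (vspace V)"
      using im by blast
    then show "?g (x \<oplus>\<^bsub>vspace W\<^esub> y) = ?g x \<oplus>\<^bsub>vspace V\<^esub> ?g y" using cl gf by (simp flip: add)
  next
    fix c x assume "c \<in> carrier K" "x \<in> carrier (vspace W)"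
    moreover then obtain a where "x = f a" "a \<in> carrier (vspace V)" using im by blast
    ultimately show "?g (c \<odot>\<^bsub>vspace W\<^esub> x) = c \<odot>\<^bsub>vspace V\<^esub> ?g x" using cl gf by (simp flip: smult)
  next
    fix l x assume x: "x \<in> level W l"
    then obtain a where a: "x = f a" "a \<in> level V l" using lev[of l] by blast
    then show "?g x \<in> level V l" using gf[OF lc(1)[OF a(2)]] lc(2)[OF x] by simp
  next
    show "?g \<in> carrier (vspace W) \<rightarrow> carrier (vspace V)" using im by (auto intro: inv_into_into)
  qed simp
  show ?thesis
    unfolding flag_iso_def
    by (intro bexI[OF _ f] bexI[OF _ g]) (use gf cl im in \<open>auto simp: f_inv_into_f inv_into_into\<close>)
qed

text \<open>Forgetting the inverse leaves an injection that carries levels onto levels, the form in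
  which isomorphisms are composed, added and restricted to a level.\<close>

lemma flag_isoE:
  assumes "flag_iso K V W" and V: "fin_flag K V" and W: "fin_flag K W"
  obtains f where "f \<in> flag_hom K V W" "inj_on f (carrier (vspace V))" "\<And>l. f ` level V l = level W l"
proof -
  note vs = fin_flag_vs(1)[OF V] fin_flag_vs(1)[OF W]
  obtain f g where f: "f \<in> flag_hom K V W" and g: "g \<in> flag_hom K W V"
    and gf: "\<And>v. v \<in> carrier (vspace V) \<Longrightarrow> g (f v) = v"
    and fg: "\<And>w. w \<in> carrier (vspace W) \<Longrightarrow> f (g w) = w"
    using assms(1) by (auto simp: flag_iso_def)
  have "f ` level V l = level W l" for l
  proof
    show "f ` level V l \<subseteq> level W l" using f by (auto simp: flag_hom_def)
    show "level W l \<subseteq> f ` level V l"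
    proof
      fix w assume w: "w \<in> level W l"
      then have "g w \<in> level V l" using g by (auto simp: flag_hom_def)
      then show "w \<in> f ` level V l" using fg w fin_flag_level(2)[OF W] by (metis image_eqI subsetD)
    qed
  qed
  then show ?thesis using f gf by (intro that[of f]) (auto intro: inj_on_inverseI[of _ g])
qed

lemma flag_iso_sym: "flag_iso K V W \<Longrightarrow> flag_iso K W V"
  by (auto simp: flag_iso_def)

lemma flag_iso_trans:
  assumes UV: "flag_iso K U V" and VW: "flag_iso K V W"
    and U: "fin_flag K U" and V: "fin_flag K V" and W: "fin_flag K W"
  shows "flag_iso K U W"
proof -
  note vs = fin_flag_vs(1)[OF U] fin_flag_vs(1)[OF V] fin_flag_vs(1)[OF W]
  obtain f where f: "f \<in> flag_hom K U V" "inj_on f (carrier (vspace U))" "\<And>l. f ` level U l = level V l"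
    using flag_isoE[OF UV U V] by blast
  obtain g where g: "g \<in> flag_hom K V W" "inj_on g (carrier (vspace V))" "\<And>l. g ` level V l = level W l"
    using flag_isoE[OF VW V W] by blast
  note h = f(1)[unfolded flag_hom_iff[OF vs(1,2)]] g(1)[unfolded flag_hom_iff[OF vs(2,3)]]
  show ?thesis
  proof (rule flag_isoI[of K U W "\<lambda>x. g (f x)"])
    show "inj_on (\<lambda>x. g (f x)) (carrier (vspace U))"
      using f(2) g(2) h by (auto simp: inj_on_def Pi_iff)
    show "(\<lambda>x. g (f x)) ` level U l = level W l" for l
      using f(3)[of l] g(3)[of l] by (metis image_image)
  qed (use U W h in \<open>auto simp: Pi_iff\<close>)
qed

lemma flag_iso_dims:
  assumes iso: "flag_iso K V W" and V: "fin_flag K V" and W: "fin_flag K W"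
  shows "flag_dims K V = flag_dims K W"
proof
  fix l
  note vs = fin_flag_vs(1)[OF V] fin_flag_vs(1)[OF W]
  obtain f where f: "f \<in> flag_hom K V W" "inj_on f (carrier (vspace V))" "\<And>l. f ` level V l = level W l"
    using flag_isoE[OF iso V W] by blast
  note h = f(1)[unfolded flag_hom_iff[OF vs]]
  note lc = fin_flag_level(2)[OF V, of l, THEN subsetD]
  \<comment> \<open>An isomorphism of flags restricts to a linear isomorphism of each level, and the
    dimensions are compared there.\<close>
  interpret lm: linear_map K "vspace V\<lparr>carrier := level V l\<rparr>" "vspace W\<lparr>carrier := level W l\<rparr>" f
    using h lc fin_flag_level_fin_dim(1)[OF V, of l] fin_flag_level_fin_dim(1)[OF W, of l]
    by (intro linear_mapI) auto
  show "flag_dims K V l = flag_dims K W l"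
    unfolding flag_dims_def
    by (rule lm.dim_eq[OF fin_flag_level_fin_dim(2)[OF V]])
      (use f(3) inj_on_subset[OF f(2) fin_flag_level(2)[OF V]] in auto)
qed

section \<open>Levelwise sums of flags\<close>

lemma flag_sum_simps [simp]:
  "carrier (vspace (flag_sum V W)) = carrier (vspace V) \<times> carrier (vspace W)"
  "\<zero>\<^bsub>vspace (flag_sum V W)\<^esub> = (\<zero>\<^bsub>vspace V\<^esub>, \<zero>\<^bsub>vspace W\<^esub>)"
  "a \<oplus>\<^bsub>vspace (flag_sum V W)\<^esub> b = (fst a \<oplus>\<^bsub>vspace V\<^esub> fst b, snd a \<oplus>\<^bsub>vspace W\<^esub> snd b)"
  "c \<odot>\<^bsub>vspace (flag_sum V W)\<^esub> a = (c \<odot>\<^bsub>vspace V\<^esub> fst a, c \<odot>\<^bsub>vspace W\<^esub> snd a)"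
  "level (flag_sum V W) l = level V l \<times> level W l"
  by (simp_all add: flag_sum_def)

lemma fin_flag_sum:
  assumes V: "fin_flag K V" and W: "fin_flag K W"
  shows "fin_flag K (flag_sum V W)"
proof -
  have vs: "vectorspace K (direct_sum (vspace V) (vspace W))"
    by (intro direct_sum_is_vs fin_flag_vs[OF V] fin_flag_vs[OF W])
  have fd: "vectorspace.fin_dim K (direct_sum (vspace V) (vspace W))"
    by (intro direct_sum_fin_dim fin_flag_vs[OF V] fin_flag_vs[OF W])
  have "subspace K (level V l \<times> level W l) (direct_sum (vspace V) (vspace W))" for l
    unfolding subspace_def submodule_def
    using vs fin_flag_level(2-5)[OF V, where l = l] fin_flag_level(2-5)[OF W, where l = l]
    by (auto simp: vectorspace_def)
  moreover have "level V (Suc l) \<times> level W (Suc l) \<subseteq> level V l \<times> level W l" for l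
    using fin_flag_level(6)[OF V, of l "Suc l"] fin_flag_level(6)[OF W, of l "Suc l"] by auto
  moreover have "finite_depth (flag_sum V W)"
  proof -
    obtain m n where n: "level V m = {\<zero>\<^bsub>vspace V\<^esub>}" "level W n = {\<zero>\<^bsub>vspace W\<^esub>}"
      using V W by (auto simp: fin_flag_def finite_depth_def)
    have "level V (m + n) = {\<zero>\<^bsub>vspace V\<^esub>}" "level W (m + n) = {\<zero>\<^bsub>vspace W\<^esub>}"
      using fin_flag_level(3,6)[OF V] fin_flag_level(3,6)[OF W] n le_add1 le_add2
      by (metis subset_singletonD empty_iff)+
    then show ?thesis by (auto simp: finite_depth_def flag_sum_def)
  qed
  ultimately show ?thesis
    using vs fd fin_flag_level(1)[OF V] fin_flag_level(1)[OF W]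
    by (simp add: fin_flag_def is_flag_def flag_sum_def)
qed

lemma flag_dims_sum:
  assumes V: "fin_flag K V" and W: "fin_flag K W"
  shows "flag_dims K (flag_sum V W) = (\<lambda>l. flag_dims K V l + flag_dims K W l)"
proof
  fix l
  have "vspace (flag_sum V W)\<lparr>carrier := level (flag_sum V W) l\<rparr>
    = direct_sum (vspace V\<lparr>carrier := level V l\<rparr>) (vspace W\<lparr>carrier := level W l\<rparr>)"
    by (simp add: flag_sum_def direct_sum_def)
  then show "flag_dims K (flag_sum V W) l = flag_dims K V l + flag_dims K W l"
    using direct_sum_dim[OF fin_flag_level_fin_dim(1)[OF V] fin_flag_level_fin_dim(1)[OF W]
        fin_flag_level_fin_dim(2)[OF V] fin_flag_level_fin_dim(2)[OF W]]
    by (simp add: flag_dims_def)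
qed

text \<open>The first summand is fixed because the classification compares two flags from which the
  same line has been split off.\<close>

lemma flag_sum_cong:
  assumes iso: "flag_iso K V W" and U: "fin_flag K U" and V: "fin_flag K V" and W: "fin_flag K W"
  shows "flag_iso K (flag_sum U V) (flag_sum U W)"
proof -
  note vs = fin_flag_vs(1)[OF V] fin_flag_vs(1)[OF W]
  obtain f where f: "f \<in> flag_hom K V W" "inj_on f (carrier (vspace V))" "\<And>l. f ` level V l = level W l"
    using flag_isoE[OF iso V W] by blast
  note h = f(1)[unfolded flag_hom_iff[OF vs]]
  show ?thesis
  proof (rule flag_isoI[of _ _ _ "map_prod id f"])
    show "map_prod id f ` level (flag_sum U V) l = level (flag_sum U W) l" for l
      using f(3)[of l] by (simp add: map_prod_surj_on)
    show "inj_on (map_prod id f) (carrier (vspace (flag_sum U V)))"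
      using f(2) by (simp add: map_prod_inj_on)
  qed (use h in \<open>auto intro: fin_flag_sum U V W\<close>)
qed

section \<open>Classification of flags by their dimensions\<close>

text \<open>The vectors are the field elements themselves, whatever the universe; a copy in another
  type comes from \<open>flag_transport\<close>. With levels indexed from 0, the levels
  \<open>0\<close> to \<open>n\<close> are full, so a line contributes \<open>n + 1\<close> ones to
  a dimension sequence.\<close>

definition line :: "('k, 'r) ring_scheme \<Rightarrow> nat \<Rightarrow> ('k, 'k) flag" where
  "line K n = \<lparr>vspace = \<lparr>carrier = carrier K, mult = undefined, one = undefined,
      zero = \<zero>\<^bsub>K\<^esub>, add = (\<oplus>\<^bsub>K\<^esub>), smult = (\<otimes>\<^bsub>K\<^esub>)\<rparr>,
    level = (\<lambda>l. if l \<le> n then carrier K else {\<zero>\<^bsub>K\<^esub>})\<rparr>"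

lemma line_simps [simp]:
  "carrier (vspace (line K n)) = carrier K"
  "\<zero>\<^bsub>vspace (line K n)\<^esub> = \<zero>\<^bsub>K\<^esub>"
  "x \<oplus>\<^bsub>vspace (line K n)\<^esub> y = x \<oplus>\<^bsub>K\<^esub> y"
  "c \<odot>\<^bsub>vspace (line K n)\<^esub> x = c \<otimes>\<^bsub>K\<^esub> x"
  "level (line K n) l = (if l \<le> n then carrier K else {\<zero>\<^bsub>K\<^esub>})"
  by (simp_all add: line_def)

lemma line:
  assumes K: "field K"
  shows "fin_flag K (line K n)" and "flag_dims K (line K n) = (\<lambda>l. if l \<le> n then 1 else 0)"
proof -
  interpret K: field K by (rule K)
  interpret L: vectorspace K "vspace (line K n)"
  proof (rule vs_criteria[OF K], goal_cases)
    case 3 show ?case using K.add.r_inv_ex by auto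
  qed (auto simp: K.a_ac K.m_assoc K.l_distr K.r_distr)
  have "L.span {\<one>\<^bsub>K\<^esub>} = carrier K"
  proof -
    have sm: "submodule K (L.span {\<one>\<^bsub>K\<^esub>}) (vspace (line K n))"
      by (intro L.span_is_submodule) simp
    have "c \<in> L.span {\<one>\<^bsub>K\<^esub>}" if "c \<in> carrier K" for c
      using submodule.smult_closed[OF sm that, of "\<one>\<^bsub>K\<^esub>"] L.span_self[of "\<one>\<^bsub>K\<^esub>"] that by simp
    then show ?thesis using L.span_is_subset2[of "{\<one>\<^bsub>K\<^esub>}"] by auto
  qed
  then have gen: "L.gen_set {\<one>\<^bsub>K\<^esub>}" by simp
  then have fd: "L.fin_dim" unfolding L.fin_dim_def by (intro exI[of _ "{\<one>\<^bsub>K\<^esub>}"]) auto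
  have sub: "subspace K (level (line K n) l) (vspace (line K n))" for l
    unfolding subspace_def submodule_def
    using L.vectorspace_axioms L.module_axioms by auto
  show fin: "fin_flag K (line K n)"
    unfolding fin_flag_def is_flag_def finite_depth_def
    using L.vectorspace_axioms fd sub
    by (intro conjI exI[of _ "Suc n"]) (auto simp: less_Suc_eq_le)
  have "L.dim = 1" using gen by (intro L.dim1I) auto
  moreover have "flag_dims K (line K n) l = flag_dims K (line K n) 0" if "l \<le> n" for l
    using that by (simp add: flag_dims_def)
  ultimately have "flag_dims K (line K n) l = 1" if "l \<le> n" for l
    using that flag_dims_0[OF fin] by metis
  moreover have "flag_dims K (line K n) l = 0" if "\<not> l \<le> n" for l
    using that by (simp add: flag_dims_eq_0_iff[OF fin])
  ultimately show "flag_dims K (line K n) = (\<lambda>l. if l \<le> n then 1 else 0)" by auto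
qed

text \<open>The complement is a subspace with the induced levels. It therefore keeps the vector type
  of \<open>V\<close> and can be split again in an induction.\<close>

lemma flag_split_line:
  fixes V :: "('k, 'v) flag"
  assumes V: "fin_flag K V" and n: "level V n \<noteq> {\<zero>\<^bsub>vspace V\<^esub>}"
    "level V (Suc n) = {\<zero>\<^bsub>vspace V\<^esub>}"
  obtains H :: "('k, 'v) flag" where "fin_flag K H" "flag_iso K (flag_sum (line K n) H) V"
proof -
  interpret V: vectorspace K "vspace V" by (rule fin_flag_vs[OF V])
  note lev = fin_flag_level[OF V]
  note lc = lev(2)[THEN subsetD]
  obtain v where v: "v \<in> level V n" "v \<noteq> \<zero>\<^bsub>vspace V\<^esub>" using n(1) lev(3) by blast
  note vc = lc[OF v(1)]
  obtain h where h: "\<And>x. x \<in> carrier (vspace V) \<Longrightarrow> h x \<in> carrier K"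
    and ha: "\<And>x y. \<lbrakk>x \<in> carrier (vspace V); y \<in> carrier (vspace V)\<rbrakk> \<Longrightarrow> h (x \<oplus>\<^bsub>vspace V\<^esub> y) = h x \<oplus>\<^bsub>K\<^esub> h y"
    and hs: "\<And>c x. \<lbrakk>c \<in> carrier K; x \<in> carrier (vspace V)\<rbrakk> \<Longrightarrow> h (c \<odot>\<^bsub>vspace V\<^esub> x) = c \<otimes>\<^bsub>K\<^esub> h x"
    and hv: "h v = \<one>\<^bsub>K\<^esub>"
    using V.exists_linear_functional[OF fin_flag_vs(2)[OF V] vc v(2)] by blast
  have h0: "h \<zero>\<^bsub>vspace V\<^esub> = \<zero>\<^bsub>K\<^esub>"
    using hs[of "\<zero>\<^bsub>K\<^esub>" v] vc h[OF vc] by simp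
  define S where "S = {x \<in> carrier (vspace V). h x = \<zero>\<^bsub>K\<^esub>}"
  define H where "H = \<lparr>vspace = (vspace V)\<lparr>carrier := S\<rparr>, level = (\<lambda>l. level V l \<inter> S)\<rparr>"
  have H_simps [simp]: "carrier (vspace H) = S" "\<zero>\<^bsub>vspace H\<^esub> = \<zero>\<^bsub>vspace V\<^esub>"
    "x \<oplus>\<^bsub>vspace H\<^esub> y = x \<oplus>\<^bsub>vspace V\<^esub> y" "c \<odot>\<^bsub>vspace H\<^esub> x = c \<odot>\<^bsub>vspace V\<^esub> x"
    "level H l = level V l \<inter> S" for x y c l
    by (simp_all add: H_def)
  have sub: "subspace K S (vspace V)"
    unfolding subspace_def submodule_def
    using V.vectorspace_axioms V.module_axioms ha hs h0 by (auto simp: S_def)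
  have vsH: "vectorspace K (vspace H)" using V.subspace_is_vs[OF sub] by (simp add: H_def)
  then interpret H: vectorspace K "vspace H" .
  have fdH: "H.fin_dim"
    using V.subspace_fin_dim(1)[OF fin_flag_vs(2)[OF V] sub] by (simp add: H_def)
  have "subspace K (level H l) (vspace H)" for l
    unfolding subspace_def submodule_def
    using H.vectorspace_axioms H.module_axioms lev submodule.m_closed[OF V.is_module[OF sub]]
      submodule.smult_closed[OF V.is_module[OF sub]] submodule.zero_closed[OF V.is_module[OF sub]]
    by auto
  moreover have "level V (Suc l) \<inter> S \<subseteq> level V l \<inter> S" for l using lev(6)[of l "Suc l"] by auto
  moreover have "level H (Suc n) = {\<zero>\<^bsub>vspace H\<^esub>}" using n(2) h0 by (auto simp: S_def)
  ultimately have finH: "fin_flag K H"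
    unfolding fin_flag_def is_flag_def finite_depth_def
    using vsH fdH lev(1) by (auto simp: S_def)
  have K: "field K" ..
  let ?f = "\<lambda>(c, x). c \<odot>\<^bsub>vspace V\<^esub> v \<oplus>\<^bsub>vspace V\<^esub> x"
  \<comment> \<open>The functional recovers the coordinate on the line from the sum, which makes
    \<open>?f\<close> injective.\<close>
  have hf: "h (?f (c, x)) = c" if "c \<in> carrier K" "x \<in> S" for c x
    using that vc by (simp add: ha hs hv S_def)
  have "flag_iso K (flag_sum (line K n) H) V"
  proof (rule flag_isoI[of _ _ _ ?f])
    show "inj_on ?f (carrier (vspace (flag_sum (line K n) H)))"
    proof (rule inj_onI)
      fix p q assume "p \<in> carrier (vspace (flag_sum (line K n) H))"
        "q \<in> carrier (vspace (flag_sum (line K n) H))" and eq: "?f p = ?f q"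
      then obtain c x d y where p: "p = (c, x)" "q = (d, y)" "c \<in> carrier K" "x \<in> S" "d \<in> carrier K" "y \<in> S"
        by auto
      then have "c = d" using hf eq by metis
      then show "p = q" using eq p vc by (auto simp: S_def)
    qed
    show "?f ` level (flag_sum (line K n) H) l = level V l" for l
    proof (cases "l \<le> n")
      case True
      then have vl: "v \<in> level V l" using v(1) lev(6) by blast
      have "x \<in> ?f ` (carrier K \<times> (level V l \<inter> S))" if x: "x \<in> level V l" for x
      proof (rule image_eqI)
        \<comment> \<open>The component of \<open>x\<close> in the kernel of \<open>h\<close>, along
          \<open>v\<close>. It stays in \<open>level V l\<close> because \<open>v\<close> lies there
          too; this is where \<open>l \<le> n\<close> matters.\<close>
        let ?y = "(\<ominus>\<^bsub>K\<^esub> h x) \<odot>\<^bsub>vspace V\<^esub> v \<oplus>\<^bsub>vspace V\<^esub> x"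
        note xc = lc[OF x]
        have "?y \<in> S" using xc vc h[OF xc] by (simp add: S_def ha hs hv V.R.l_neg)
        moreover have "?y \<in> level V l" using x vl h[OF xc] by (intro lev) auto
        ultimately show "(h x, ?y) \<in> carrier K \<times> (level V l \<inter> S)" using h[OF xc] by simp
        have "?f (h x, ?y) = (h x \<odot>\<^bsub>vspace V\<^esub> v \<oplus>\<^bsub>vspace V\<^esub> (\<ominus>\<^bsub>K\<^esub> h x) \<odot>\<^bsub>vspace V\<^esub> v) \<oplus>\<^bsub>vspace V\<^esub> x"
          using xc vc h[OF xc] by (simp add: V.a_assoc)
        also have "h x \<odot>\<^bsub>vspace V\<^esub> v \<oplus>\<^bsub>vspace V\<^esub> (\<ominus>\<^bsub>K\<^esub> h x) \<odot>\<^bsub>vspace V\<^esub> v = \<zero>\<^bsub>vspace V\<^esub>"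
          using vc h[OF xc] by (simp flip: V.smult_l_distr add: V.R.r_neg)
        finally show "x = ?f (h x, ?y)" using xc by simp
      qed
      then show ?thesis using True vl lev(4,5) by auto
    next
      case False
      then have "level V l = {\<zero>\<^bsub>vspace V\<^esub>}" using n(2) lev(3)[of l] lev(6)[of "Suc n" l] by auto
      then show ?thesis using False vc h0 by (auto simp: S_def)
    qed
  next
    show "?f (p \<oplus>\<^bsub>vspace (flag_sum (line K n) H)\<^esub> q) = ?f p \<oplus>\<^bsub>vspace V\<^esub> ?f q"
      if "p \<in> carrier (vspace (flag_sum (line K n) H))" "q \<in> carrier (vspace (flag_sum (line K n) H))" for p q
      using that vc by (auto simp: S_def V.smult_l_distr V.a_ac)
    show "?f (c \<odot>\<^bsub>vspace (flag_sum (line K n) H)\<^esub> p) = c \<odot>\<^bsub>vspace V\<^esub> ?f p"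
      if "c \<in> carrier K" "p \<in> carrier (vspace (flag_sum (line K n) H))" for c p
      using that vc by (auto simp: S_def V.smult_r_distr V.smult_assoc1)
  qed (use vc finH V line[OF K] in \<open>auto simp: S_def intro!: fin_flag_sum\<close>)
  with finH show ?thesis by (rule that)
qed

lemma dim_seqs_eq_zero:
  assumes "d \<in> carrier dim_seqs" "d 0 = 0"
  shows "d = (\<lambda>_. 0)"
proof
  show "d l = 0" for l using assms antimonoD[of d 0 l] by (simp add: dim_seqs_def)
qed

lemma last_nonzero_level:
  assumes "d \<in> carrier dim_seqs" "d 0 \<noteq> 0"
  obtains n where "\<And>l. d l = 0 \<longleftrightarrow> n < l"
proof -
  have anti: "antimono d" and ex: "\<exists>n. d n = 0" using assms(1) by (auto simp: dim_seqs_def)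
  \<comment> \<open>Since \<open>d 0\<close> is nonzero, the first zero index is positive and the
    subtraction does not truncate.\<close>
  define n where "n = (LEAST n. d n = 0) - 1"
  have "(LEAST n. d n = 0) \<noteq> 0" using LeastI_ex[OF ex] assms(2) by (metis)
  then have "d (Suc n) = 0" "d n \<noteq> 0"
    using LeastI_ex[OF ex] not_less_Least[of n "\<lambda>n. d n = 0"] by (auto simp: n_def)
  then have "d l = 0 \<longleftrightarrow> n < l" for l
    using antimonoD[OF anti, of l n] antimonoD[OF anti, of "Suc n" l] by (cases "n < l") auto
  then show ?thesis using that by blast
qed

text \<open>With \<open>n\<close> read off from the sequence rather than from the levels, the same
  line is split from any two flags with equal sequences.\<close>

lemma flag_split:
  fixes V :: "('k, 'v) flag"
  assumes V: "fin_flag K V" and n: "\<And>l. flag_dims K V l = 0 \<longleftrightarrow> n < l"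
  obtains H :: "('k, 'v) flag" where "fin_flag K H" "flag_iso K (flag_sum (line K n) H) V"
    "flag_dims K V = (\<lambda>l. (if l \<le> n then 1 else 0) + flag_dims K H l)"
proof -
  have K: "field K" using fin_flag_vs(1)[OF V] by (simp add: vectorspace_def)
  have "level V n \<noteq> {\<zero>\<^bsub>vspace V\<^esub>}" "level V (Suc n) = {\<zero>\<^bsub>vspace V\<^esub>}"
    using n by (simp_all flip: flag_dims_eq_0_iff[OF V])
  then obtain H :: "('k, 'v) flag" where H: "fin_flag K H" "flag_iso K (flag_sum (line K n) H) V"
    using flag_split_line[OF V] by blast
  have "flag_dims K V = flag_dims K (flag_sum (line K n) H)"
    using flag_iso_dims[OF H(2) fin_flag_sum[OF line(1)[OF K] H(1)] V] by simp
  also have "\<dots> = (\<lambda>l. (if l \<le> n then 1 else 0) + flag_dims K H l)"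
    by (simp add: flag_dims_sum[OF line(1)[OF K] H(1)] line(2)[OF K])
  finally show ?thesis using that H by blast
qed

text \<open>After the same line is split from both flags, cancellation of natural numbers gives
  complements with equal sequences, smaller by one at index 0. The vector types are kept apart
  because one flag will later be a levelwise sum and the other an object in the universe.\<close>

lemma flag_iso_if_dims_eq:
  fixes V :: "('k, 'v) flag" and W :: "('k, 'w) flag"
  assumes "fin_flag K V" "fin_flag K W" "flag_dims K V = flag_dims K W"
  shows "flag_iso K V W"
  using assms
proof (induction "flag_dims K V 0" arbitrary: V W)
  case 0
  note V = \<open>fin_flag K V\<close> and W = \<open>fin_flag K W\<close>
  interpret V: vectorspace K "vspace V" by (rule fin_flag_vs[OF V])
  interpret W: vectorspace K "vspace W" by (rule fin_flag_vs[OF W])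
  have *: "level V l = {\<zero>\<^bsub>vspace V\<^esub>}" "level W l = {\<zero>\<^bsub>vspace W\<^esub>}" for l
    using 0 fin_flag_level(3)[OF V, of l] fin_flag_level(6)[OF V, of 0 l]
      fin_flag_level(3)[OF W, of l] fin_flag_level(6)[OF W, of 0 l]
      flag_dims_eq_0_iff[OF V, of 0] flag_dims_eq_0_iff[OF W, of 0] by auto
  have c: "carrier (vspace V) = {\<zero>\<^bsub>vspace V\<^esub>}"
    using *(1)[of 0] fin_flag_level(1)[OF V] by simp
  show ?case
    by (rule flag_isoI[OF V W, of "\<lambda>_. \<zero>\<^bsub>vspace W\<^esub>"]) (simp_all add: * c)
next
  case (Suc d)
  note V = \<open>fin_flag K V\<close> and W = \<open>fin_flag K W\<close>
  have K: "field K" using fin_flag_vs(1)[OF V] by (simp add: vectorspace_def)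
  have nz: "flag_dims K V 0 \<noteq> 0" using Suc.hyps(2) by simp
  obtain n where n: "\<And>l. flag_dims K V l = 0 \<longleftrightarrow> n < l"
    using last_nonzero_level[OF flag_dims_closed[OF V] nz] by blast
  obtain H :: "('k, 'v) flag" where H: "fin_flag K H" "flag_iso K (flag_sum (line K n) H) V"
    "flag_dims K V = (\<lambda>l. (if l \<le> n then 1 else 0) + flag_dims K H l)"
    using flag_split[OF V n] .
  obtain H' :: "('k, 'w) flag" where H': "fin_flag K H'" "flag_iso K (flag_sum (line K n) H') W"
    "flag_dims K W = (\<lambda>l. (if l \<le> n then 1 else 0) + flag_dims K H' l)"
    using flag_split[OF W n[unfolded \<open>flag_dims K V = flag_dims K W\<close>]] .
  have "flag_dims K H = flag_dims K H'"
    using H(3) H'(3) Suc.prems(3) by (simp add: fun_eq_iff)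
  moreover have "d = flag_dims K H 0" using Suc.hyps(2) fun_cong[OF H(3), of 0] by simp
  ultimately have "flag_iso K H H'" using Suc.hyps(1) H(1) H'(1) by blast
  then have "flag_iso K (flag_sum (line K n) H) (flag_sum (line K n) H')"
    by (intro flag_sum_cong line K H H')
  then have "flag_iso K (flag_sum (line K n) H) W"
    using H'(2) by (rule flag_iso_trans) (intro fin_flag_sum line K H H' W)+
  with flag_iso_sym[OF H(2)] show ?case
    by (rule flag_iso_trans) (intro fin_flag_sum line K H V W)+
qed

section \<open>Flags in a given universe\<close>

text \<open>Transport of structure: the operations on the image are conjugated by \<open>h\<close>
  and its partial inverse. This brings lines and levelwise sums, built in other types, into the
  universe.\<close>

lemma flag_transport:
  fixes V :: "('k, 'w) flag" and h :: "'w \<Rightarrow> 'v"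
  assumes V: "fin_flag K V" and h: "inj_on h (carrier (vspace V))"
  obtains W :: "('k, 'v) flag" where "fin_flag K W" "flag_iso K V W"
proof -
  interpret V: vectorspace K "vspace V" by (rule fin_flag_vs[OF V])
  note lev = fin_flag_level[OF V]
  let ?C = "carrier (vspace V)"
  let ?g = "inv_into ?C h"
  have g [simp]: "x \<in> ?C \<Longrightarrow> ?g (h x) = x" for x using h by (rule inv_into_f_f)
  define W :: "('k, 'v) flag" where
    "W = \<lparr>vspace = \<lparr>carrier = h ` ?C, mult = undefined, one = undefined, zero = h \<zero>\<^bsub>vspace V\<^esub>,
        add = (\<lambda>x y. h (?g x \<oplus>\<^bsub>vspace V\<^esub> ?g y)), smult = (\<lambda>c x. h (c \<odot>\<^bsub>vspace V\<^esub> ?g x))\<rparr>,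
      level = (\<lambda>l. h ` level V l)\<rparr>"
  have W_simps [simp]: "carrier (vspace W) = h ` ?C" "\<zero>\<^bsub>vspace W\<^esub> = h \<zero>\<^bsub>vspace V\<^esub>"
    "x \<oplus>\<^bsub>vspace W\<^esub> y = h (?g x \<oplus>\<^bsub>vspace V\<^esub> ?g y)" "c \<odot>\<^bsub>vspace W\<^esub> x = h (c \<odot>\<^bsub>vspace V\<^esub> ?g x)"
    "level W l = h ` level V l" for x y c l
    by (simp_all add: W_def)
  have lc: "x \<in> level V l \<Longrightarrow> x \<in> ?C" for x l using lev(2) by blast
  interpret W: vectorspace K "vspace W"
  proof (rule vs_criteria, goal_cases)
    case 1 show ?case ..
  next
    case 4 show ?case
    proof
      fix v assume "v \<in> carrier (vspace W)"
      then obtain x where "x \<in> ?C" "v = h x" by auto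
      then show "\<exists>w\<in>carrier (vspace W). v \<oplus>\<^bsub>vspace W\<^esub> w = \<zero>\<^bsub>vspace W\<^esub>"
        by (intro bexI[of _ "h (\<ominus>\<^bsub>vspace V\<^esub> x)"]) (auto simp: V.r_neg)
    qed
  qed (auto simp: V.a_ac V.smult_l_distr V.smult_r_distr V.smult_assoc1)
  have lm: "linear_map K (vspace V) (vspace W) h"
    by (rule linear_mapI) (auto intro: V.vectorspace_axioms W.vectorspace_axioms)
  have fd: "W.fin_dim" by (rule linear_map.surj_fin_dim[OF lm fin_flag_vs(2)[OF V]]) simp
  have "subspace K (h ` level V l) (vspace W)" for l
    unfolding subspace_def submodule_def
  proof (intro conjI W.vectorspace_axioms W.module_axioms subsetI allI impI)
    fix x assume "x \<in> h ` level V l"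
    then show "x \<in> carrier (vspace W)" using lc by auto
  next
    fix x y assume "x \<in> h ` level V l" "y \<in> h ` level V l"
    then obtain a b where ab: "x = h a" "y = h b" "a \<in> level V l" "b \<in> level V l" by blast
    then show "x \<oplus>\<^bsub>vspace W\<^esub> y \<in> h ` level V l" using lc[OF ab(3)] lc[OF ab(4)] lev(4) by simp
  next
    fix c x assume c: "c \<in> carrier K" and "x \<in> h ` level V l"
    then obtain a where a: "x = h a" "a \<in> level V l" by blast
    then show "c \<odot>\<^bsub>vspace W\<^esub> x \<in> h ` level V l" using c lc[OF a(2)] lev(5) by simp
  qed (use lev(3) in simp)
  moreover have "h ` level V (Suc l) \<subseteq> h ` level V l" for l
    using lev(6)[of l "Suc l"] by (intro image_mono) simp
  moreover have "finite_depth W"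
    using V by (force simp: fin_flag_def finite_depth_def)
  ultimately have W: "fin_flag K W"
    unfolding fin_flag_def is_flag_def using W.vectorspace_axioms fd lev(1) by auto
  moreover have "flag_iso K V W"
    by (rule flag_isoI[OF V W, of h]) (use h in auto)
  ultimately show ?thesis using that by blast
qed

lemma zero_flag:
  assumes K: "field K"
  obtains V :: "('k, 'v) flag" where "fin_flag K V" "flag_dims K V = (\<lambda>_. 0)"
proof -
  \<comment> \<open>Every type contains \<open>undefined\<close>, which serves as the only
    vector.\<close>
  define V :: "('k, 'v) flag" where
    "V = \<lparr>vspace = \<lparr>carrier = {undefined}, mult = undefined, one = undefined, zero = undefined,
        add = (\<lambda>_ _. undefined), smult = (\<lambda>_ _. undefined)\<rparr>, level = (\<lambda>_. {undefined})\<rparr>"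
  interpret V: vectorspace K "vspace V" by (rule vs_criteria[OF K]) (simp_all add: V_def)
  have fd: "V.fin_dim"
    unfolding V.fin_dim_def using V.in_own_span[of "carrier (vspace V)"] V.span_is_subset2[of "carrier (vspace V)"]
    by (intro exI[of _ "carrier (vspace V)"]) (auto simp: V_def)
  have "subspace K {undefined} (vspace V)"
    unfolding subspace_def submodule_def
    using V.vectorspace_axioms V.module_axioms by (auto simp: V_def)
  then have V: "fin_flag K V"
    unfolding fin_flag_def is_flag_def finite_depth_def
    using V.vectorspace_axioms fd by (simp add: V_def)
  moreover have "flag_dims K V = (\<lambda>_. 0)"
    using flag_dims_eq_0_iff[OF V] by (auto simp: V_def)
  ultimately show ?thesis using that by blast
qed

text \<open>An infinite type is in bijection with its square, so the levelwise sum in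
  \<open>'v \<times> 'v\<close> fits back into \<open>'v\<close>.\<close>

lemma flag_sum_in_universe:
  fixes V W :: "('k, 'v) flag"
  assumes inf: "infinite (UNIV :: 'v set)" and "fin_flag K V" "fin_flag K W"
  obtains X :: "('k, 'v) flag" where "fin_flag K X" "flag_iso K (flag_sum V W) X"
proof -
  obtain h :: "'v \<times> 'v \<Rightarrow> 'v" where "inj h"
    using card_of_Times_same_infinite[OF inf] by (auto simp: bij_betw_def simp flip: card_of_ordIso)
  then have "inj_on h (carrier (vspace (flag_sum V W)))" by (rule inj_on_subset) simp
  from flag_transport[OF fin_flag_sum[OF assms(2,3)] this] that show ?thesis by blast
qed

text \<open>Induction on \<open>d 0\<close>: subtracting the sequence of the longest line that fits
  leaves an admissible sequence, and the line is added back as a levelwise summand.\<close>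

lemma flag_of_dims:
  fixes K :: "('k, 'r) ring_scheme"
  assumes K: "field K" and univ: "lists (carrier K) \<lesssim> (UNIV :: 'v set)"
    and "d \<in> carrier dim_seqs"
  obtains V :: "('k, 'v) flag" where "fin_flag K V" "flag_dims K V = d"
  using assms(3)
proof (induction "d 0" arbitrary: d thesis)
  case 0
  then have "d = (\<lambda>_. 0)" using dim_seqs_eq_zero[of d] by simp
  moreover obtain V :: "('k, 'v) flag" where "fin_flag K V" "flag_dims K V = (\<lambda>_. 0)"
    using zero_flag[OF K] .
  ultimately show ?case using 0 by blast
next
  case (Suc m)
  interpret K: field K by (rule K)
  obtain \<iota> :: "'k list \<Rightarrow> 'v" where \<iota>: "inj_on \<iota> (lists (carrier K))"
    using univ by (auto simp: lepoll_def)
  \<comment> \<open>The lists of ones, one for each length, make the universe infinite even over a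
    finite field.\<close>
  have "inj_on (\<lambda>n. replicate n \<one>\<^bsub>K\<^esub>) UNIV" by (metis injI length_replicate)
  moreover have "range (\<lambda>n. replicate n \<one>\<^bsub>K\<^esub>) \<subseteq> lists (carrier K)" by auto
  ultimately have "infinite (lists (carrier K))" by (metis finite_imageD finite_subset infinite_UNIV_nat)
  then have inf: "infinite (UNIV :: 'v set)"
    using \<iota> by (metis finite_imageD finite_subset subset_UNIV)
  obtain n where n: "\<And>l. d l = 0 \<longleftrightarrow> n < l"
    using last_nonzero_level[of d] Suc by auto
  have anti: "antimono d" using Suc.prems by (simp add: dim_seqs_def)
  \<comment> \<open>The subtraction is exact, as \<open>d l\<close> is positive for
    \<open>l \<le> n\<close>. The result is still non-increasing: the entries up to \<open>n\<close>
    all drop by one, and those beyond \<open>n\<close> are already zero.\<close>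
  define e where "e l = d l - (if l \<le> n then 1 else 0)" for l
  have "e l \<le> e k" if "k \<le> l" for k l
    using antimonoD[OF anti that] that n[of l] by (auto simp: e_def)
  moreover have "e i = 0" if "i \<ge> Suc n" for i using that n[of i] by (simp add: e_def)
  ultimately have e: "e \<in> carrier dim_seqs" "m = e 0"
    using Suc.hyps(2) by (auto simp: dim_seqs_def monotone_def) (simp add: e_def)
  obtain V :: "('k, 'v) flag" where V: "fin_flag K V" "flag_dims K V = e"
    using Suc.hyps(1)[of e] e by blast
  \<comment> \<open>One-element lists embed the field in the universe.\<close>
  have "inj_on (\<lambda>c. \<iota> [c]) (carrier (vspace (line K n)))"
    by (rule inj_onI) (use inj_onD[OF \<iota>] in fastforce)
  then obtain L :: "('k, 'v) flag" where L: "fin_flag K L" "flag_iso K (line K n) L"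
    using flag_transport[OF line(1)[OF K]] by blast
  obtain X :: "('k, 'v) flag" where X: "fin_flag K X" "flag_iso K (flag_sum L V) X"
    using flag_sum_in_universe[OF inf L(1) V(1)] .
  have "flag_dims K X l = d l" for l
    using fun_cong[OF flag_iso_dims[OF X(2) fin_flag_sum[OF L(1) V(1)] X(1)], of l]
      fun_cong[OF flag_iso_dims[OF L(2) line(1)[OF K] L(1)], of l] n[of l]
    by (auto simp: flag_dims_sum[OF L(1) V(1)] line(2)[OF K] V(2) e_def split: if_splits)
  then show ?case using Suc.prems X(1) by blast
qed

section \<open>Preadditive categories\<close>

context preadditive_category
begin

lemma zero_cmp:
  assumes "X \<in> obj C" "Y \<in> obj C" "Z \<in> obj C" "f \<in> carrier (mor C X Y)"
  shows "cmp C X Y Z \<zero>\<^bsub>mor C Y Z\<^esub> f = \<zero>\<^bsub>mor C X Z\<^esub>"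
proof -
  interpret XZ: abelian_group "mor C X Z" by (intro mor_group assms)
  interpret YZ: abelian_group "mor C Y Z" by (intro mor_group assms)
  let ?x = "cmp C X Y Z \<zero>\<^bsub>mor C Y Z\<^esub> f"
  have c: "?x \<in> carrier (mor C X Z)" by (intro cmp_closed assms) simp
  \<comment> \<open>A group element equal to its own double is zero; the double arises by
    distributing composition over a sum of two zeros.\<close>
  have "?x \<oplus>\<^bsub>mor C X Z\<^esub> ?x = ?x"
    using cmp_add_left[OF assms YZ.zero_closed YZ.zero_closed] by simp
  then show ?thesis using c XZ.add.r_cancel_one by metis
qed

lemma cmp_zero:
  assumes "X \<in> obj C" "Y \<in> obj C" "Z \<in> obj C" "h \<in> carrier (mor C Y Z)"
  shows "cmp C X Y Z h \<zero>\<^bsub>mor C X Y\<^esub> = \<zero>\<^bsub>mor C X Z\<^esub>"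
proof -
  interpret XZ: abelian_group "mor C X Z" by (intro mor_group assms)
  interpret XY: abelian_group "mor C X Y" by (intro mor_group assms)
  let ?x = "cmp C X Y Z h \<zero>\<^bsub>mor C X Y\<^esub>"
  have c: "?x \<in> carrier (mor C X Z)" by (intro cmp_closed assms) simp
  have "?x \<oplus>\<^bsub>mor C X Z\<^esub> ?x = ?x"
    using cmp_add_right[OF assms(1-3) XY.zero_closed XY.zero_closed assms(4)] by simp
  then show ?thesis using c XZ.add.r_cancel_one by metis
qed

lemma cmp_finsum:
  assumes XYZ: "X \<in> obj C" "Y \<in> obj C" "Z \<in> obj C" and h: "h \<in> carrier (mor C Y Z)"
    and "finite I" "\<And>i. i \<in> I \<Longrightarrow> a i \<in> carrier (mor C X Y)"
  shows "cmp C X Y Z h (\<Oplus>\<^bsub>mor C X Y\<^esub>i\<in>I. a i) = (\<Oplus>\<^bsub>mor C X Z\<^esub>i\<in>I. cmp C X Y Z h (a i))"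
proof -
  interpret XZ: abelian_group "mor C X Z" by (intro mor_group XYZ)
  interpret XY: abelian_group "mor C X Y" by (intro mor_group XYZ)
  show ?thesis
    using assms(5,6)
  proof (induction I rule: finite_induct)
    case empty
    then show ?case by (simp add: cmp_zero[OF XYZ h])
  next
    case (insert i I)
    have c: "cmp C X Y Z h (a k) \<in> carrier (mor C X Z)" if "k \<in> insert i I" for k
      using that insert.prems h XYZ by (intro cmp_closed) auto
    have "(\<Oplus>\<^bsub>mor C X Y\<^esub>i\<in>I. a i) \<in> carrier (mor C X Y)"
      using insert.prems by (intro XY.finsum_closed) auto
    then show ?case
      using insert c by (simp add: XY.finsum_insert XZ.finsum_insert Pi_iff cmp_add_right[OF XYZ _ _ h])
  qed
qed

lemma finsum_cmp:
  assumes XYZ: "X \<in> obj C" "Y \<in> obj C" "Z \<in> obj C" and f: "f \<in> carrier (mor C X Y)"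
    and "finite I" "\<And>i. i \<in> I \<Longrightarrow> a i \<in> carrier (mor C Y Z)"
  shows "cmp C X Y Z (\<Oplus>\<^bsub>mor C Y Z\<^esub>i\<in>I. a i) f = (\<Oplus>\<^bsub>mor C X Z\<^esub>i\<in>I. cmp C X Y Z (a i) f)"
proof -
  interpret XZ: abelian_group "mor C X Z" by (intro mor_group XYZ)
  interpret YZ: abelian_group "mor C Y Z" by (intro mor_group XYZ)
  show ?thesis
    using assms(5,6)
  proof (induction I rule: finite_induct)
    case empty
    then show ?case by (simp add: zero_cmp[OF XYZ f])
  next
    case (insert i I)
    have c: "cmp C X Y Z (a k) f \<in> carrier (mor C X Z)" if "k \<in> insert i I" for k
      using that insert.prems f XYZ by (intro cmp_closed) auto
    have "(\<Oplus>\<^bsub>mor C Y Z\<^esub>i\<in>I. a i) \<in> carrier (mor C Y Z)"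
      using insert.prems by (intro YZ.finsum_closed) auto
    then show ?case
      using insert c by (simp add: YZ.finsum_insert XZ.finsum_insert Pi_iff cmp_add_left[OF XYZ f])
  qed
qed

text \<open>Biproducts nest: each member of \<open>Ys\<close> is reached from \<open>X\<close>
  through \<open>B\<close>. Biproducts of lists, required for additivity and for the Krull-Schmidt
  decomposition, are thereby reduced to binary ones, for which the comparison with levelwise sums is
  available.\<close>

lemma is_direct_sum_Cons:
  assumes "is_direct_sum C [A, B] X" "is_direct_sum C Ys B"
  shows "is_direct_sum C (A # Ys) X"
proof -
  obtain i p where b1: "is_biproduct C [A, B] X i p" using assms(1) by (auto simp: is_direct_sum_def)
  obtain j q where b2: "is_biproduct C Ys B j q" using assms(2) by (auto simp: is_direct_sum_def)
  let ?n = "length Ys"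
  have all2: "(\<forall>i<Suc (Suc 0). P i) \<longleftrightarrow> P 0 \<and> P (Suc 0)" for P
    by (auto simp: less_Suc_eq)
  have l2: "{..<Suc (Suc 0)} = {0, Suc 0}" by auto
  have o: "A \<in> obj C" "B \<in> obj C" "X \<in> obj C" using b1 by (auto simp: is_biproduct_def)
  have oY: "Ys ! k \<in> obj C" if "k < ?n" for k using b2 that by (auto simp: is_biproduct_def)
  have ip: "i 0 \<in> carrier (mor C A X)" "p 0 \<in> carrier (mor C X A)"
    "i 1 \<in> carrier (mor C B X)" "p 1 \<in> carrier (mor C X B)"
    "cmp C A X A (p 0) (i 0) = idn C A" "cmp C B X B (p 1) (i 1) = idn C B"
    "cmp C A X B (p 1) (i 0) = \<zero>\<^bsub>mor C A B\<^esub>" "cmp C B X A (p 0) (i 1) = \<zero>\<^bsub>mor C B A\<^esub>"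
    using b1 by (auto simp: is_biproduct_def all2)
  note ip = ip ip[unfolded One_nat_def]
  have jq: "j k \<in> carrier (mor C (Ys ! k) B)" "q k \<in> carrier (mor C B (Ys ! k))" if "k < ?n" for k
    using b2 that by (auto simp: is_biproduct_def)
  have qj: "cmp C (Ys ! k) B (Ys ! l) (q l) (j k)
      = (if k = l then idn C (Ys ! k) else \<zero>\<^bsub>mor C (Ys ! k) (Ys ! l)\<^esub>)" if "k < ?n" "l < ?n" for k l
    using b2 that by (auto simp: is_biproduct_def)
  have jqs: "(\<Oplus>\<^bsub>mor C B B\<^esub>k\<in>{..<?n}. cmp C B (Ys ! k) B (j k) (q k)) = idn C B"
    using b2 by (simp add: is_biproduct_def)
  interpret XX: abelian_group "mor C X X" by (intro mor_group o)
  have cc: "cmp C X A X (i 0) (p 0) \<in> carrier (mor C X X)" "cmp C X B X (i 1) (p 1) \<in> carrier (mor C X X)"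
    by (intro cmp_closed o ip)+
  have ips: "cmp C X A X (i 0) (p 0) \<oplus>\<^bsub>mor C X X\<^esub> cmp C X B X (i 1) (p 1) = idn C X"
  proof -
    have "(\<Oplus>\<^bsub>mor C X X\<^esub>k\<in>{0, Suc 0}. cmp C X ([A, B] ! k) X (i k) (p k)) = idn C X"
      using b1 by (simp add: is_biproduct_def l2)
    then show ?thesis using cc by simp
  qed
  \<comment> \<open>Index 0 belongs to \<open>A\<close>; index \<open>Suc k\<close> belongs to entry
    \<open>k\<close> of \<open>Ys\<close> and factors through \<open>B\<close>.\<close>
  define \<iota> where "\<iota> = case_nat (i 0) (\<lambda>k. cmp C (Ys ! k) B X (i 1) (j k))"
  define \<pi> where "\<pi> = case_nat (p 0) (\<lambda>k. cmp C X B (Ys ! k) (q k) (p 1))"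
  have s [simp]: "\<iota> 0 = i 0" "\<pi> 0 = p 0" "\<iota> (Suc k) = cmp C (Ys ! k) B X (i 1) (j k)"
    "\<pi> (Suc k) = cmp C X B (Ys ! k) (q k) (p 1)" for k
    by (simp_all add: \<iota>_def \<pi>_def)
  have \<iota>\<pi>: "\<iota> (Suc k) \<in> carrier (mor C (Ys ! k) X)" "\<pi> (Suc k) \<in> carrier (mor C X (Ys ! k))"
    if "k < ?n" for k
    unfolding s by (intro cmp_closed o oY ip jq that)+
  have "cmp C (Ys ! k) X A (p 0) (\<iota> (Suc k)) = \<zero>\<^bsub>mor C (Ys ! k) A\<^esub>" if "k < ?n" for k
    unfolding s using oY[OF that] jq[OF that] o ip by (simp add: cmp_assoc zero_cmp)
  moreover have "cmp C A X (Ys ! k) (\<pi> (Suc k)) (i 0) = \<zero>\<^bsub>mor C A (Ys ! k)\<^esub>" if "k < ?n" for k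
    unfolding s using oY[OF that] jq[OF that] o ip by (simp add: cmp_zero flip: cmp_assoc)
  moreover have "cmp C (Ys ! k) X (Ys ! l) (\<pi> (Suc l)) (\<iota> (Suc k))
      = (if k = l then idn C (Ys ! k) else \<zero>\<^bsub>mor C (Ys ! k) (Ys ! l)\<^esub>)"
    if k: "k < ?n" and l: "l < ?n" for k l
  proof -
    note cl = oY[OF k] oY[OF l] jq[OF k] jq[OF l] o ip
    have "cmp C (Ys ! k) X (Ys ! l) (\<pi> (Suc l)) (\<iota> (Suc k))
      = cmp C (Ys ! k) B (Ys ! l) (q l) (cmp C (Ys ! k) X B (p 1) (\<iota> (Suc k)))"
      unfolding s(4) by (rule cmp_assoc[symmetric]) (use cl \<iota>\<pi>(1)[OF k] in \<open>simp_all del: s\<close>)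
    also have "cmp C (Ys ! k) X B (p 1) (\<iota> (Suc k)) = j k"
      unfolding s using cl by (simp add: cmp_assoc idn_cmp)
    finally show ?thesis using qj[OF k l] by simp
  qed
  ultimately have delta: "cmp C ((A # Ys) ! k) X ((A # Ys) ! l) (\<pi> l) (\<iota> k)
      = (if k = l then idn C ((A # Ys) ! k) else \<zero>\<^bsub>mor C ((A # Ys) ! k) ((A # Ys) ! l)\<^esub>)"
    if "k < Suc ?n" "l < Suc ?n" for k l
    using that ip(5) by (cases k; cases l) (simp_all del: s(3,4))
  have clos: "\<iota> k \<in> carrier (mor C ((A # Ys) ! k) X) \<and> \<pi> k \<in> carrier (mor C X ((A # Ys) ! k))"
    if "k < Suc ?n" for k
    using that ip \<iota>\<pi> by (cases k) (simp_all del: s(3,4))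
  \<comment> \<open>Reassociated so that \<open>i 1\<close> and \<open>p 1\<close> can be pulled out
    of the sum over \<open>k\<close>; what remains inside adds up to the identity of
    \<open>B\<close>.\<close>
  have summand: "cmp C X (Ys ! k) X (\<iota> (Suc k)) (\<pi> (Suc k))
      = cmp C X B X (i 1) (cmp C X B B (cmp C B (Ys ! k) B (j k) (q k)) (p 1))" if k: "k < ?n" for k
  proof -
    note cl = oY[OF k] jq[OF k] o ip
    have "cmp C X (Ys ! k) X (\<iota> (Suc k)) (\<pi> (Suc k))
      = cmp C X B X (i 1) (cmp C X (Ys ! k) B (j k) (\<pi> (Suc k)))"
      unfolding s(3) using cl \<iota>\<pi>(2)[OF k] by (simp add: cmp_assoc del: s(4))
    also have "cmp C X (Ys ! k) B (j k) (\<pi> (Suc k)) = cmp C X B B (cmp C B (Ys ! k) B (j k) (q k)) (p 1)"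
      unfolding s using cl by (simp add: cmp_assoc)
    finally show ?thesis .
  qed
  have jqc: "cmp C B (Ys ! k) B (j k) (q k) \<in> carrier (mor C B B)" if "k < ?n" for k
    by (intro cmp_closed o oY jq that)
  have "(\<Oplus>\<^bsub>mor C X X\<^esub>k\<in>{..<?n}. cmp C X (Ys ! k) X (\<iota> (Suc k)) (\<pi> (Suc k)))
    = (\<Oplus>\<^bsub>mor C X X\<^esub>k\<in>{..<?n}. cmp C X B X (i 1) (cmp C X B B (cmp C B (Ys ! k) B (j k) (q k)) (p 1)))"
    by (rule XX.finsum_cong') (use summand in \<open>auto intro!: cmp_closed o ip jqc\<close>)
  also have "\<dots> = cmp C X B X (i 1) (\<Oplus>\<^bsub>mor C X B\<^esub>k\<in>{..<?n}. cmp C X B B (cmp C B (Ys ! k) B (j k) (q k)) (p 1))"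
    by (rule cmp_finsum[symmetric]) (auto intro!: cmp_closed o ip jqc)
  also have "\<dots> = cmp C X B X (i 1) (cmp C X B B (\<Oplus>\<^bsub>mor C B B\<^esub>k\<in>{..<?n}. cmp C B (Ys ! k) B (j k) (q k)) (p 1))"
    by (subst finsum_cmp) (auto intro!: cmp_closed o ip jqc)
  also have "\<dots> = cmp C X B X (i 1) (p 1)" using jqs o ip by (simp add: idn_cmp)
  finally have tail: "(\<Oplus>\<^bsub>mor C X X\<^esub>k\<in>{..<?n}. cmp C X (Ys ! k) X (\<iota> (Suc k)) (\<pi> (Suc k)))
    = cmp C X B X (i 1) (p 1)" .
  let ?F = "\<lambda>k. cmp C X ((A # Ys) ! k) X (\<iota> k) (\<pi> k)"
  have FC: "?F k \<in> carrier (mor C X X)" if "k < Suc ?n" for k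
    using that clos[OF that] o oY by (intro cmp_closed) (auto simp: nth_Cons split: nat.split)
  have "(\<Oplus>\<^bsub>mor C X X\<^esub>k\<in>{..<Suc ?n}. ?F k)
    = ?F 0 \<oplus>\<^bsub>mor C X X\<^esub> (\<Oplus>\<^bsub>mor C X X\<^esub>k\<in>Suc ` {..<?n}. ?F k)"
    unfolding lessThan_Suc_eq_insert_0 by (rule XX.finsum_insert) (use FC cc in auto)
  also have "(\<Oplus>\<^bsub>mor C X X\<^esub>k\<in>Suc ` {..<?n}. ?F k) = (\<Oplus>\<^bsub>mor C X X\<^esub>k\<in>{..<?n}. ?F (Suc k))"
    by (rule XX.finsum_reindex) (use FC in auto)
  also have "\<dots> = cmp C X B X (i 1) (p 1)" using tail by simp
  finally have "(\<Oplus>\<^bsub>mor C X X\<^esub>k\<in>{..<Suc ?n}. ?F k) = idn C X" using ips by simp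
  then have "is_biproduct C (A # Ys) X \<iota> \<pi>"
    using o b2 clos delta by (auto simp: is_biproduct_def simp del: s)
  then show ?thesis by (auto simp: is_direct_sum_def)
qed

lemma ring_end_ring:
  assumes X: "X \<in> obj C"
  shows "ring (end_ring C X)"
proof -
  interpret XX: abelian_group "mor C X X" by (intro mor_group X)
  have "abelian_group (end_ring C X)"
    by (rule abelian_groupI) (auto simp: end_ring_def XX.a_ac intro: XX.add.l_inv_ex)
  moreover have "monoid (end_ring C X)"
    by (rule monoidI) (auto simp: end_ring_def X cmp_closed idn_closed cmp_idn idn_cmp cmp_assoc)
  ultimately show ?thesis
    by (rule ringI) (auto simp: end_ring_def X cmp_add_left cmp_add_right)
qed

end

text \<open>Zero is then the only nonunit, and zero plus zero is zero. This is the criterion applied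
  to the endomorphisms of a line.\<close>

lemma local_ringI:
  assumes R: "ring R" and "\<one>\<^bsub>R\<^esub> \<noteq> \<zero>\<^bsub>R\<^esub>"
    and unit: "\<And>a. \<lbrakk>a \<in> carrier R; a \<noteq> \<zero>\<^bsub>R\<^esub>\<rbrakk> \<Longrightarrow> a \<in> Units R"
  shows "local_ring R"
proof -
  interpret ring R by (rule R)
  have "\<zero>\<^bsub>R\<^esub> \<notin> Units R" using assms(2) by (auto simp: Units_def)
  then show ?thesis using R assms(2) unit by (force simp: local_ring_def)
qed

section \<open>The category of flags\<close>

lemma Flag_fin_simps [simp]:
  "mor (Flag_fin K) = flag_mor K"
  "idn (Flag_fin K) V = (\<lambda>v \<in> carrier (vspace V). v)"
  "cmp (Flag_fin K) U V W g f = compose (carrier (vspace U)) g f"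
  by (simp_all add: Flag_fin_def)

lemma flag_mor_simps [simp]:
  "carrier (flag_mor K V W) = flag_hom K V W"
  "\<zero>\<^bsub>flag_mor K V W\<^esub> = (\<lambda>v \<in> carrier (vspace V). \<zero>\<^bsub>vspace W\<^esub>)"
  "f \<oplus>\<^bsub>flag_mor K V W\<^esub> g = (\<lambda>v \<in> carrier (vspace V). f v \<oplus>\<^bsub>vspace W\<^esub> g v)"
  by (simp_all add: flag_mor_def)

lemma flag_hom_restrictI:
  assumes V: "fin_flag K V" and W: "fin_flag K W"
    and "\<And>x y. \<lbrakk>x \<in> carrier (vspace V); y \<in> carrier (vspace V)\<rbrakk>
        \<Longrightarrow> f (x \<oplus>\<^bsub>vspace V\<^esub> y) = f x \<oplus>\<^bsub>vspace W\<^esub> f y"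
    and "\<And>c x. \<lbrakk>c \<in> carrier K; x \<in> carrier (vspace V)\<rbrakk>
        \<Longrightarrow> f (c \<odot>\<^bsub>vspace V\<^esub> x) = c \<odot>\<^bsub>vspace W\<^esub> f x"
    and lev: "\<And>l x. x \<in> level V l \<Longrightarrow> f x \<in> level W l"
  shows "restrict f (carrier (vspace V)) \<in> flag_hom K V W"
proof -
  note vs = fin_flag_vs(1)[OF V] fin_flag_vs(1)[OF W]
  interpret V: vectorspace K "vspace V" by (rule vs)
  have "f x \<in> carrier (vspace W)" if "x \<in> carrier (vspace V)" for x
    using lev[of x 0] that fin_flag_level(1)[OF V] fin_flag_level(1)[OF W] by simp
  moreover have "restrict f (carrier (vspace V)) x \<in> level W l" if "x \<in> level V l" for x l
    using that lev[OF that] fin_flag_level(2)[OF V, of l] by auto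
  ultimately show ?thesis
    unfolding flag_hom_iff[OF vs] using assms(3,4) by simp
qed

lemma flag_homD:
  assumes "fin_flag K V" "fin_flag K W" "f \<in> flag_hom K V W"
  shows "f \<in> extensional (carrier (vspace V))"
    and "x \<in> carrier (vspace V) \<Longrightarrow> f x \<in> carrier (vspace W)"
    and "\<lbrakk>x \<in> carrier (vspace V); y \<in> carrier (vspace V)\<rbrakk> \<Longrightarrow> f (x \<oplus>\<^bsub>vspace V\<^esub> y) = f x \<oplus>\<^bsub>vspace W\<^esub> f y"
    and "\<lbrakk>c \<in> carrier K; x \<in> carrier (vspace V)\<rbrakk> \<Longrightarrow> f (c \<odot>\<^bsub>vspace V\<^esub> x) = c \<odot>\<^bsub>vspace W\<^esub> f x"
    and "x \<in> level V l \<Longrightarrow> f x \<in> level W l"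
  using assms(3) unfolding flag_hom_iff[OF fin_flag_vs(1)[OF assms(1)] fin_flag_vs(1)[OF assms(2)]]
  by auto

lemma abelian_group_flag_mor:
  assumes V: "fin_flag K V" and W: "fin_flag K W"
  shows "abelian_group (flag_mor K V W)"
proof -
  interpret V: vectorspace K "vspace V" by (rule fin_flag_vs[OF V])
  interpret W: vectorspace K "vspace W" by (rule fin_flag_vs[OF W])
  note D = flag_homD[OF V W]
  have zero: "(\<lambda>v \<in> carrier (vspace V). \<zero>\<^bsub>vspace W\<^esub>) \<in> flag_hom K V W"
    by (rule flag_hom_restrictI[OF V W]) (simp_all add: fin_flag_level(3)[OF W])
  show ?thesis
  proof (rule abelian_groupI, unfold flag_mor_simps)
    fix f g assume f: "f \<in> flag_hom K V W" and g: "g \<in> flag_hom K V W"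
    show "(\<lambda>v \<in> carrier (vspace V). f v \<oplus>\<^bsub>vspace W\<^esub> g v) \<in> flag_hom K V W"
      by (rule flag_hom_restrictI[OF V W])
        (simp_all add: D[OF f] D[OF g] W.a_ac W.smult_r_distr fin_flag_level(4)[OF W])
    show "(\<lambda>v \<in> carrier (vspace V). f v \<oplus>\<^bsub>vspace W\<^esub> g v) = (\<lambda>v \<in> carrier (vspace V). g v \<oplus>\<^bsub>vspace W\<^esub> f v)"
      by (rule restrict_ext) (simp add: D(2)[OF f] D(2)[OF g] W.a_comm)
    fix h assume h: "h \<in> flag_hom K V W"
    show "(\<lambda>v \<in> carrier (vspace V). (\<lambda>v \<in> carrier (vspace V). f v \<oplus>\<^bsub>vspace W\<^esub> g v) v \<oplus>\<^bsub>vspace W\<^esub> h v)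
      = (\<lambda>v \<in> carrier (vspace V). f v \<oplus>\<^bsub>vspace W\<^esub> (\<lambda>v \<in> carrier (vspace V). g v \<oplus>\<^bsub>vspace W\<^esub> h v) v)"
      by (rule restrict_ext) (simp add: D(2)[OF f] D(2)[OF g] D(2)[OF h] W.a_assoc)
  next
    fix f assume f: "f \<in> flag_hom K V W"
    show "(\<lambda>v \<in> carrier (vspace V). (\<lambda>v \<in> carrier (vspace V). \<zero>\<^bsub>vspace W\<^esub>) v \<oplus>\<^bsub>vspace W\<^esub> f v) = f"
      by (rule extensionalityI[of _ "carrier (vspace V)"]) (simp_all add: D[OF f])
    \<comment> \<open>The negative is formed as the multiple by minus one, so closure of the levels
      under scalars makes it a flag morphism.\<close>
    let ?g = "\<lambda>v \<in> carrier (vspace V). (\<ominus>\<^bsub>K\<^esub> \<one>\<^bsub>K\<^esub>) \<odot>\<^bsub>vspace W\<^esub> f v"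
    have "?g \<in> flag_hom K V W"
      by (rule flag_hom_restrictI[OF V W])
        (simp_all add: D[OF f] W.smult_r_distr V.R.m_comm fin_flag_level(5)[OF W] flip: W.smult_assoc1)
    moreover have "(\<lambda>v \<in> carrier (vspace V). ?g v \<oplus>\<^bsub>vspace W\<^esub> f v) = (\<lambda>v \<in> carrier (vspace V). \<zero>\<^bsub>vspace W\<^esub>)"
      by (rule restrict_ext) (simp add: D(2)[OF f] W.smult_minus_1 W.l_neg)
    ultimately show "\<exists>g\<in>flag_hom K V W. (\<lambda>v \<in> carrier (vspace V). g v \<oplus>\<^bsub>vspace W\<^esub> f v)
        = (\<lambda>v \<in> carrier (vspace V). \<zero>\<^bsub>vspace W\<^esub>)"
      by (intro bexI[of _ ?g])
  qed (rule zero)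
qed

lemma preadditive_Flag_fin:
  fixes K :: "('k, 'r) ring_scheme"
  shows "preadditive_category (Flag_fin K :: (('k, 'v) flag, 'v \<Rightarrow> 'v) precat)"
proof (rule preadditive_category.intro, unfold obj_Flag_fin mem_Collect_eq Flag_fin_simps flag_mor_simps)
  fix X Y :: "('k, 'v) flag" assume X: "fin_flag K X" and Y: "fin_flag K Y"
  show "abelian_group (flag_mor K X Y)" using X Y by (rule abelian_group_flag_mor)
  show "(\<lambda>v \<in> carrier (vspace X). v) \<in> flag_hom K X X"
    by (rule flag_hom_restrictI[OF X X]) simp_all
  fix f assume f: "f \<in> flag_hom K X Y"
  show "compose (carrier (vspace X)) f (\<lambda>v \<in> carrier (vspace X). v) = f"
    "compose (carrier (vspace X)) (\<lambda>v \<in> carrier (vspace Y). v) f = f"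
    using flag_homD(1,2)[OF X Y f] by (auto simp: compose_def intro!: extensionalityI[of _ "carrier (vspace X)"])
  fix Z :: "('k, 'v) flag" assume Z: "fin_flag K Z"
  note vs = fin_flag_vs(1)[OF X] fin_flag_vs(1)[OF Y] fin_flag_vs(1)[OF Z]
  interpret X: vectorspace K "vspace X" by (rule vs)
  { fix g assume g: "g \<in> flag_hom K Y Z"
    show "compose (carrier (vspace X)) g f \<in> flag_hom K X Z"
      unfolding compose_def
      by (rule flag_hom_restrictI[OF X Z]) (simp_all add: flag_homD[OF X Y f] flag_homD[OF Y Z g])
    fix h assume h: "h \<in> flag_hom K Y Z"
    show "compose (carrier (vspace X)) (\<lambda>v \<in> carrier (vspace Y). g v \<oplus>\<^bsub>vspace Z\<^esub> h v) f
      = (\<lambda>v \<in> carrier (vspace X). compose (carrier (vspace X)) g f v \<oplus>\<^bsub>vspace Z\<^esub> compose (carrier (vspace X)) h f v)"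
      unfolding compose_def by (rule restrict_ext) (simp add: flag_homD(2)[OF X Y f]) }
  { fix g h assume g: "g \<in> flag_hom K X Y" and h: "h \<in> flag_hom K Y Z"
    show "compose (carrier (vspace X)) h (\<lambda>v \<in> carrier (vspace X). f v \<oplus>\<^bsub>vspace Y\<^esub> g v)
      = (\<lambda>v \<in> carrier (vspace X). compose (carrier (vspace X)) h f v \<oplus>\<^bsub>vspace Z\<^esub> compose (carrier (vspace X)) h g v)"
      unfolding compose_def
      by (rule restrict_ext) (simp add: flag_homD(2)[OF X Y f] flag_homD(2)[OF X Y g] flag_homD(3)[OF Y Z h]) }
  fix U :: "('k, 'v) flag" and e g h
  assume U: "fin_flag K U" and e: "e \<in> flag_hom K U X"
  show "compose (carrier (vspace U)) h (compose (carrier (vspace U)) g e)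
    = compose (carrier (vspace U)) (compose (carrier (vspace X)) h g) e"
    unfolding compose_def by (rule restrict_ext) (simp add: flag_homD(2)[OF U X e])
qed

section \<open>Isomorphism, direct sums and zero objects in terms of dimension sequences\<close>

lemma isomorphic_Flag_fin_iff:
  fixes V W :: "('k, 'v) flag"
  assumes V: "fin_flag K V" and W: "fin_flag K W"
  shows "isomorphic (Flag_fin K) V W \<longleftrightarrow> flag_dims K V = flag_dims K W"
proof -
  \<comment> \<open>Composites and identities are extensional on the carrier, so an equation between
    them is a pointwise condition there.\<close>
  have *: "compose A g f = (\<lambda>x\<in>A. x) \<longleftrightarrow> (\<forall>x\<in>A. g (f x) = x)" for A :: "'v set" and f g
    by (auto simp: compose_def fun_eq_iff restrict_def)
  have "isomorphic (Flag_fin K) V W \<longleftrightarrow> flag_iso K V W"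
    by (simp add: isomorphic_def flag_iso_def *)
  then show ?thesis
    using flag_iso_dims[OF _ V W] flag_iso_if_dims_eq[OF V W] by blast
qed

text \<open>Dimension sequences add in levelwise sums and are a complete invariant across vector
  types. From here on a binary direct sum is exhibited by adding sequences, without writing down
  injections and projections.\<close>

lemma is_direct_sum_pair_iff:
  assumes V: "fin_flag K V" and W: "fin_flag K W" and X: "fin_flag K X"
  shows "is_direct_sum (Flag_fin K) [V, W] X
    \<longleftrightarrow> flag_dims K X = (\<lambda>l. flag_dims K V l + flag_dims K W l)"
proof -
  note S = fin_flag_sum[OF V W]
  have "is_direct_sum (Flag_fin K) [V, W] X \<longleftrightarrow> flag_iso K (flag_sum V W) X"
    using V W X by (subst is_direct_sum_Flag_fin_iff) (auto simp: obj_Flag_fin flag_iso_def)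
  also have "\<dots> \<longleftrightarrow> flag_dims K (flag_sum V W) = flag_dims K X"
    using flag_iso_dims[OF _ S X] flag_iso_if_dims_eq[OF S X] by blast
  finally show ?thesis by (auto simp: flag_dims_sum[OF V W])
qed

text \<open>An empty sum of morphisms is the zero map, so the identity of \<open>X\<close> is zero
  and the total space vanishes; a non-increasing sequence that starts with 0 is 0
  throughout.\<close>

lemma is_direct_sum_Nil_iff:
  assumes X: "fin_flag K X"
  shows "is_direct_sum (Flag_fin K) [] X \<longleftrightarrow> flag_dims K X = (\<lambda>_. 0)"
proof -
  interpret X: vectorspace K "vspace X" by (rule fin_flag_vs[OF X])
  interpret E: abelian_group "flag_mor K X X" by (rule abelian_group_flag_mor[OF X X])
  have "is_direct_sum (Flag_fin K) [] X
      \<longleftrightarrow> (\<lambda>v \<in> carrier (vspace X). \<zero>\<^bsub>vspace X\<^esub>) = (\<lambda>v \<in> carrier (vspace X). v)"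
    using X by (simp add: is_direct_sum_def is_biproduct_def obj_Flag_fin)
  also have "\<dots> \<longleftrightarrow> carrier (vspace X) = {\<zero>\<^bsub>vspace X\<^esub>}"
    using X.M.zero_closed by (auto simp: fun_eq_iff restrict_def)
  also have "\<dots> \<longleftrightarrow> flag_dims K X 0 = 0"
    by (simp add: flag_dims_eq_0_iff[OF X] fin_flag_level(1)[OF X])
  also have "\<dots> \<longleftrightarrow> flag_dims K X = (\<lambda>_. 0)"
    using dim_seqs_eq_zero[OF flag_dims_closed[OF X]] by auto
  finally show ?thesis .
qed

section \<open>Endomorphisms of lines and the Krull-Schmidt property\<close>

lemma (in vectorspace) dim_1E:
  assumes "fin_dim" "dim = 1"
  obtains v where "v \<in> carrier V" "v \<noteq> \<zero>\<^bsub>V\<^esub>" "\<And>x. x \<in> carrier V \<Longrightarrow> \<exists>c\<in>carrier K. x = c \<odot>\<^bsub>V\<^esub> v"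
proof -
  obtain B where B: "finite B" "basis B" using finite_basis_exists[OF assms(1)] by blast
  then have "card B = 1" using assms(2) dim_basis by simp
  then obtain v where v: "B = {v}" by (auto simp: card_1_singleton_iff)
  have vc: "v \<in> carrier V" using B(2) v by (simp add: basis_def)
  have "v \<noteq> \<zero>\<^bsub>V\<^esub>" using B(2) v vs_zero_lin_dep[of B] by (auto simp: basis_def)
  moreover have "\<exists>c\<in>carrier K. x = c \<odot>\<^bsub>V\<^esub> v" if "x \<in> carrier V" for x
  proof -
    have "x \<in> span {v}" using B(2) v that by (simp add: basis_def)
    then obtain a where "a \<in> {v} \<rightarrow> carrier K" "lincomb a {v} = x"
      using finite_in_span[of "{v}" x] vc by auto
    then show ?thesis using vc by (intro bexI[of _ "a v"]) (auto simp: lincomb_def)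
  qed
  ultimately show ?thesis using that vc by blast
qed

text \<open>Every endomorphism of a flag with one-dimensional total space is a scalar.\<close>

lemma local_end_ring:
  fixes K :: "('k, 'r) ring_scheme" and V :: "('k, 'v) flag"
  assumes V: "fin_flag K V" and d: "flag_dims K V 0 = 1"
  shows "local_ring (end_ring (Flag_fin K) V)"
proof -
  interpret V: vectorspace K "vspace V" by (rule fin_flag_vs[OF V])
  interpret P: preadditive_category "Flag_fin K :: (('k, 'v) flag, 'v \<Rightarrow> 'v) precat"
    by (rule preadditive_Flag_fin)
  have E: "carrier (end_ring (Flag_fin K) V) = flag_hom K V V"
    "\<one>\<^bsub>end_ring (Flag_fin K) V\<^esub> = (\<lambda>v \<in> carrier (vspace V). v)"
    "\<zero>\<^bsub>end_ring (Flag_fin K) V\<^esub> = (\<lambda>v \<in> carrier (vspace V). \<zero>\<^bsub>vspace V\<^esub>)"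
    "f \<otimes>\<^bsub>end_ring (Flag_fin K) V\<^esub> g = compose (carrier (vspace V)) f g" for f g
    by (simp_all add: end_ring_def)
  obtain v where v: "v \<in> carrier (vspace V)" "v \<noteq> \<zero>\<^bsub>vspace V\<^esub>"
    and gen: "\<And>x. x \<in> carrier (vspace V) \<Longrightarrow> \<exists>c\<in>carrier K. x = c \<odot>\<^bsub>vspace V\<^esub> v"
    using V.dim_1E[OF fin_flag_vs(2)[OF V]] d flag_dims_0[OF V] by auto
  show ?thesis
  proof (rule local_ringI)
    show "ring (end_ring (Flag_fin K) V)"
      using V by (intro P.ring_end_ring) (simp add: obj_Flag_fin)
    show "\<one>\<^bsub>end_ring (Flag_fin K) V\<^esub> \<noteq> \<zero>\<^bsub>end_ring (Flag_fin K) V\<^esub>"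
      unfolding E using v by (metis restrict_apply')
    fix f assume "f \<in> carrier (end_ring (Flag_fin K) V)" and nz: "f \<noteq> \<zero>\<^bsub>end_ring (Flag_fin K) V\<^esub>"
    then have f: "f \<in> flag_hom K V V" by (simp add: E)
    note D = flag_homD[OF V V f]
    obtain c where c: "c \<in> carrier K" "f v = c \<odot>\<^bsub>vspace V\<^esub> v" using gen D(2) v(1) by blast
    \<comment> \<open>Since \<open>x\<close> is a multiple of \<open>v\<close> and the field is
      commutative, the scalar \<open>c\<close> found at \<open>v\<close> works for every
      \<open>x\<close>.\<close>
    have fx: "f x = c \<odot>\<^bsub>vspace V\<^esub> x" if x: "x \<in> carrier (vspace V)" for x
    proof -
      obtain b where b: "b \<in> carrier K" "x = b \<odot>\<^bsub>vspace V\<^esub> v" using gen[OF x] by blast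
      have "f x = b \<odot>\<^bsub>vspace V\<^esub> (c \<odot>\<^bsub>vspace V\<^esub> v)" using D(4)[OF b(1) v(1)] b(2) c(2) by simp
      also have "\<dots> = (c \<otimes>\<^bsub>K\<^esub> b) \<odot>\<^bsub>vspace V\<^esub> v"
        using b(1) c(1) v(1) V.smult_assoc1[of b c v] V.R.m_comm[of b c] by simp
      also have "\<dots> = c \<odot>\<^bsub>vspace V\<^esub> x" using b c(1) v(1) V.smult_assoc1[of c b v] by simp
      finally show ?thesis .
    qed
    have "c \<noteq> \<zero>\<^bsub>K\<^esub>"
    proof
      assume "c = \<zero>\<^bsub>K\<^esub>"
      then have "f = (\<lambda>v \<in> carrier (vspace V). \<zero>\<^bsub>vspace V\<^esub>)"
        using D(1) fx by (intro extensionalityI[of _ "carrier (vspace V)"]) auto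
      then show False using nz by (simp add: E)
    qed
    then have ic: "inv\<^bsub>K\<^esub> c \<in> carrier K" "inv\<^bsub>K\<^esub> c \<otimes>\<^bsub>K\<^esub> c = \<one>\<^bsub>K\<^esub>" "c \<otimes>\<^bsub>K\<^esub> inv\<^bsub>K\<^esub> c = \<one>\<^bsub>K\<^esub>"
      using c(1) by (auto simp: V.field_Units)
    \<comment> \<open>Multiplication by a scalar preserves every level, so the inverse is again a
      flag morphism.\<close>
    let ?g = "\<lambda>x \<in> carrier (vspace V). inv\<^bsub>K\<^esub> c \<odot>\<^bsub>vspace V\<^esub> x"
    have g: "?g \<in> flag_hom K V V"
      by (rule flag_hom_restrictI[OF V V])
        (use ic in \<open>simp_all add: V.smult_r_distr V.R.m_comm fin_flag_level(5)[OF V] flip: V.smult_assoc1\<close>)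
    have "compose (carrier (vspace V)) ?g f = (\<lambda>v \<in> carrier (vspace V). v)"
      "compose (carrier (vspace V)) f ?g = (\<lambda>v \<in> carrier (vspace V). v)"
      unfolding compose_def
      by (rule restrict_ext, use ic c(1) in \<open>simp add: fx flip: V.smult_assoc1\<close>)+
    then show "f \<in> Units (end_ring (Flag_fin K) V)"
      using f g by (auto simp: Units_def E)
  qed
qed

lemma krull_schmidt_decomposition:
  fixes K :: "('k, 'r) ring_scheme" and X :: "('k, 'v) flag"
  assumes K: "field K" and univ: "lists (carrier K) \<lesssim> (UNIV :: 'v set)" and "fin_flag K X"
  shows "\<exists>Ys. is_direct_sum (Flag_fin K) Ys X \<and> (\<forall>Y \<in> set Ys. local_ring (end_ring (Flag_fin K) Y))"
  using assms(3)
proof (induction "flag_dims K X 0" arbitrary: X)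
  case 0
  note X = \<open>fin_flag K X\<close>
  have "flag_dims K X = (\<lambda>_. 0)"
    using 0 dim_seqs_eq_zero[OF flag_dims_closed[OF X]] by simp
  then show ?case using is_direct_sum_Nil_iff[OF X] by (intro exI[of _ "[]"]) simp
next
  case (Suc d)
  note X = \<open>fin_flag K X\<close>
  interpret P: preadditive_category "Flag_fin K :: (('k, 'v) flag, 'v \<Rightarrow> 'v) precat"
    by (rule preadditive_Flag_fin)
  have nz: "flag_dims K X 0 \<noteq> 0" using Suc.hyps(2) by simp
  obtain n where n: "\<And>l. flag_dims K X l = 0 \<longleftrightarrow> n < l"
    using last_nonzero_level[OF flag_dims_closed[OF X] nz] by blast
  obtain H :: "('k, 'v) flag" where H: "fin_flag K H"
    "flag_dims K X = (\<lambda>l. (if l \<le> n then 1 else 0) + flag_dims K H l)"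
    using flag_split[OF X n] by blast
  \<comment> \<open>The line is replaced by a flag in the universe with the same sequence; sequences
    alone then show that \<open>X\<close> is the direct sum of \<open>L\<close> and
    \<open>H\<close>.\<close>
  obtain L :: "('k, 'v) flag" where L: "fin_flag K L" "flag_dims K L = flag_dims K (line K n)"
    using flag_of_dims[OF K univ flag_dims_closed[OF line(1)[OF K]]] .
  have "d = flag_dims K H 0" using Suc.hyps(2) fun_cong[OF H(2), of 0] by simp
  then obtain Ys where Ys: "is_direct_sum (Flag_fin K) Ys H"
    "\<forall>Y \<in> set Ys. local_ring (end_ring (Flag_fin K) Y)"
    using Suc.hyps(1) H(1) by blast
  have "is_direct_sum (Flag_fin K) [L, H] X"
    by (simp add: is_direct_sum_pair_iff[OF L(1) H(1) X] H(2) L(2) line(2)[OF K])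
  then have "is_direct_sum (Flag_fin K) (L # Ys) X" using Ys(1) by (rule P.is_direct_sum_Cons)
  moreover have "local_ring (end_ring (Flag_fin K) L)"
    by (rule local_end_ring[OF L(1)]) (simp add: L(2) line(2)[OF K])
  ultimately show ?case using Ys(2) by (intro exI[of _ "L # Ys"]) simp
qed

lemma krull_schmidt_Flag_fin:
  fixes K :: "('k, 'r) ring_scheme"
  assumes K: "field K" and univ: "lists (carrier K) \<lesssim> (UNIV :: 'v set)"
  shows "krull_schmidt (Flag_fin K :: (('k, 'v) flag, 'v \<Rightarrow> 'v) precat)"
proof -
  interpret P: preadditive_category "Flag_fin K :: (('k, 'v) flag, 'v \<Rightarrow> 'v) precat"
    by (rule preadditive_Flag_fin)
  have "\<exists>X. is_direct_sum (Flag_fin K) Ys X" if "set Ys \<subseteq> obj (Flag_fin K)"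
    for Ys :: "('k, 'v) flag list"
    using that
  proof (induction Ys)
    case Nil
    obtain X :: "('k, 'v) flag" where "fin_flag K X" "flag_dims K X = (\<lambda>_. 0)"
      using zero_flag[OF K] .
    then show ?case using is_direct_sum_Nil_iff by blast
  next
    case (Cons Y Ys)
    then obtain B where B: "is_direct_sum (Flag_fin K) Ys B" by auto
    have "fin_flag K B" using B by (auto simp: is_direct_sum_def is_biproduct_def obj_Flag_fin)
    moreover have "fin_flag K Y" using Cons.prems by (simp add: obj_Flag_fin)
    ultimately have YB: "fin_flag K Y" "fin_flag K B" by simp_all
    \<comment> \<open>The sequence of the levelwise sum is admissible, hence realised in the
      universe; the biproduct structure on \<open>X\<close> follows from the sequence.\<close>
    obtain X :: "('k, 'v) flag" where "fin_flag K X" "flag_dims K X = flag_dims K (flag_sum Y B)"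
      using flag_of_dims[OF K univ flag_dims_closed[OF fin_flag_sum[OF YB]]] .
    then have "is_direct_sum (Flag_fin K) [Y, B] X"
      by (simp add: is_direct_sum_pair_iff[OF YB] flag_dims_sum[OF YB])
    then show ?case using P.is_direct_sum_Cons B by blast
  qed
  then show ?thesis
    using P.preadditive_category_axioms krull_schmidt_decomposition[OF K univ]
    by (simp add: krull_schmidt_def additive_category_def obj_Flag_fin)
qed

section \<open>The monoid of isomorphism classes of flags\<close>

text \<open>By the classification this is the whole isomorphism class of each of its members.
  Indexing classes by sequences turns computations in \<open>iso_monoid\<close> into computations in
  \<open>dim_seqs\<close>.\<close>

definition dims_class :: "('k, 'r) ring_scheme \<Rightarrow> (nat \<Rightarrow> nat) \<Rightarrow> ('k, 'v) flag set" where
  "dims_class K d = {V. fin_flag K V \<and> flag_dims K V = d}"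

lemma iso_class_Flag_fin:
  assumes "fin_flag K V"
  shows "iso_class (Flag_fin K) V = dims_class K (flag_dims K V)"
  using isomorphic_Flag_fin_iff[OF assms] by (auto simp: iso_class_def dims_class_def obj_Flag_fin)

lemma is_direct_sum_obj: "is_direct_sum C Ys X \<Longrightarrow> X \<in> obj C"
  by (auto simp: is_direct_sum_def is_biproduct_def)

lemma dim_seqs_simps [simp]:
  "m \<otimes>\<^bsub>dim_seqs\<^esub> m' = (\<lambda>i. m i + m' i)" "\<one>\<^bsub>dim_seqs\<^esub> = (\<lambda>_. 0)"
  by (simp_all add: dim_seqs_def)

lemma dim_seqs_closed:
  "\<lbrakk>m \<in> carrier dim_seqs; m' \<in> carrier dim_seqs\<rbrakk> \<Longrightarrow> (\<lambda>i. m i + m' i) \<in> carrier dim_seqs"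
  "(\<lambda>_. 0) \<in> carrier dim_seqs"
proof -
  assume "m \<in> carrier dim_seqs" "m' \<in> carrier dim_seqs"
  then obtain a b where "antimono m" "antimono m'" "\<forall>i\<ge>a. m i = 0" "\<forall>i\<ge>b. m' i = 0"
    by (auto simp: dim_seqs_def)
  then show "(\<lambda>i. m i + m' i) \<in> carrier dim_seqs"
    by (auto simp: dim_seqs_def monotone_def add_mono intro!: exI[of _ "max a b"])
qed (simp add: dim_seqs_def monotone_def)

theorem proposition4p1:
  fixes K :: "('k, 'r) ring_scheme"
  assumes K: "field K"
    and universe: "lists (carrier K) \<lesssim> (UNIV :: 'v set)"
  defines "\<F> \<equiv> (Flag_fin K :: (('k, 'v) flag, 'v \<Rightarrow> 'v) precat)"
  shows "krull_schmidt \<F> \<and>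
    comm_monoid (iso_monoid \<F>) \<and>
    (\<exists>\<phi> \<in> iso (iso_monoid \<F>) dim_seqs. \<forall>V \<in> obj \<F>. \<phi> (iso_class \<F> V) = flag_dims K V)"
proof (intro conjI)
  show "krull_schmidt \<F>" unfolding \<F>_def using K universe by (rule krull_schmidt_Flag_fin)
  let ?c = "dims_class K :: (nat \<Rightarrow> nat) \<Rightarrow> ('k, 'v) flag set"
  \<comment> \<open>Every class \<open>?c d\<close> with admissible \<open>d\<close> is nonempty.
    Apart from the Krull-Schmidt property, this is where the size of the universe enters.\<close>
  have ex: "\<exists>V :: ('k, 'v) flag. fin_flag K V \<and> flag_dims K V = d" if "d \<in> carrier dim_seqs" for d
    using flag_of_dims[OF K universe that] by blast
  have carr: "carrier (iso_monoid \<F>) = ?c ` carrier dim_seqs"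
  proof -
    have "carrier (iso_monoid \<F>) = (\<lambda>V :: ('k, 'v) flag. ?c (flag_dims K V)) ` Collect (fin_flag K)"
      by (simp add: iso_monoid_def \<F>_def obj_Flag_fin iso_class_Flag_fin cong: image_cong_simp)
    also have "\<dots> = ?c ` carrier dim_seqs" using ex flag_dims_closed by fast
    finally show ?thesis .
  qed
  have one: "\<one>\<^bsub>iso_monoid \<F>\<^esub> = ?c (\<lambda>_. 0)"
    using is_direct_sum_Nil_iff is_direct_sum_obj[of \<F> "[]"]
    by (fastforce simp: iso_monoid_def dims_class_def \<F>_def obj_Flag_fin)
  \<comment> \<open>The product is a set of direct sums of representatives. It is a whole class
    because every \<open>Z\<close> with the summed sequence is a direct sum of any chosen
    \<open>X\<close> and \<open>Y\<close>; such a choice exists since both classes are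
    nonempty.\<close>
  have mult: "?c d \<otimes>\<^bsub>iso_monoid \<F>\<^esub> ?c e = ?c (\<lambda>l. d l + e l)"
    if d: "d \<in> carrier dim_seqs" and e: "e \<in> carrier dim_seqs" for d e
  proof
    show "?c d \<otimes>\<^bsub>iso_monoid \<F>\<^esub> ?c e \<subseteq> ?c (\<lambda>l. d l + e l)"
    proof
      fix Z assume "Z \<in> ?c d \<otimes>\<^bsub>iso_monoid \<F>\<^esub> ?c e"
      then obtain X Y where XY: "X \<in> ?c d" "Y \<in> ?c e" "is_direct_sum \<F> [X, Y] Z"
        by (auto simp: iso_monoid_def)
      have "fin_flag K Z" using is_direct_sum_obj[OF XY(3)] by (simp add: \<F>_def obj_Flag_fin)
      then show "Z \<in> ?c (\<lambda>l. d l + e l)"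
        using XY is_direct_sum_pair_iff[of K X Y Z] by (auto simp: dims_class_def \<F>_def)
    qed
    show "?c (\<lambda>l. d l + e l) \<subseteq> ?c d \<otimes>\<^bsub>iso_monoid \<F>\<^esub> ?c e"
    proof
      fix Z assume Z: "Z \<in> ?c (\<lambda>l. d l + e l)"
      obtain X Y where XY: "X \<in> ?c d" "Y \<in> ?c e" using ex[OF d] ex[OF e] by (auto simp: dims_class_def)
      then have "is_direct_sum \<F> [X, Y] Z"
        using Z is_direct_sum_pair_iff[of K X Y Z] by (simp add: dims_class_def \<F>_def)
      then show "Z \<in> ?c d \<otimes>\<^bsub>iso_monoid \<F>\<^esub> ?c e" using XY by (auto simp: iso_monoid_def)
    qed
  qed
  \<comment> \<open>The laws are inherited through \<open>?c\<close> from the addition of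
    sequences.\<close>
  show "comm_monoid (iso_monoid \<F>)"
    by (rule comm_monoidI)
      (auto simp: carr one mult dim_seqs_closed add_ac)
  \<comment> \<open>Any representative will do, as the sequence is constant on a class.\<close>
  define \<phi> where "\<phi> A = flag_dims K (SOME V. V \<in> A)" for A :: "('k, 'v) flag set"
  have \<phi>: "\<phi> (?c d) = d" if "d \<in> carrier dim_seqs" for d
    using someI_ex[of "\<lambda>V. V \<in> ?c d"] ex[OF that] by (auto simp: \<phi>_def dims_class_def)
  have "\<phi> \<in> hom (iso_monoid \<F>) dim_seqs"
    by (auto simp: hom_def carr mult \<phi> dim_seqs_closed)
  moreover have "bij_betw \<phi> (carrier (iso_monoid \<F>)) (carrier dim_seqs)"
    unfolding carr by (rule bij_betw_byWitness[of _ ?c]) (auto simp: \<phi>)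
  ultimately have "\<phi> \<in> iso (iso_monoid \<F>) dim_seqs" by (simp add: iso_def)
  moreover have "\<forall>V \<in> obj \<F>. \<phi> (iso_class \<F> V) = flag_dims K V"
    by (auto simp: \<F>_def obj_Flag_fin iso_class_Flag_fin \<phi> flag_dims_closed)
  ultimately show "\<exists>\<phi> \<in> iso (iso_monoid \<F>) dim_seqs. \<forall>V \<in> obj \<F>. \<phi> (iso_class \<F> V) = flag_dims K V"
    by (intro bexI[of _ \<phi>])
qed

end
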